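(* Let $M,\widetilde M$ be formal real hypersurfaces through $0\in\mathbb C^N$, and let $H\colon(\mathbb C^N,0)\to(\mathbb C^N,0)$ be a formal holomorphic mapping with $H(M)\subset\widetilde M$. If $\widetilde M$ is of finite type at $0$ and $H$ is not totally degenerate at $0$, then $H$ is CR transversal to $\widetilde M$ at $0$.
   Context: For a formal power series $f$, $\bar f$ denotes the series obtained by conjugating all coefficients. A formal real hypersurface $M$ through $0$ in $\mathbb C^N$ is given by $\rho\in\mathbb C[[Z,\zeta]]$, $Z,\zeta\in\mathbb C^N$, with $\rho(0)=0$, $\rho(Z,\zeta)=\bar\rho(\zeta,Z)$ and $\partial_{(Z,\zeta)}\rho(0)\ne0$ (then automatically $\partial_Z\rho(0)\neq0$). Set $n:=N-1$. A formal (holomorphic) mapping $H\colon(\mathbb C^N,0)\to(\mathbb C^N,0)$ is an $N$-tuple of elements of $\mathbb C[[Z]]$ without constant term. If $\widetilde M$ is another formal real hypersurface with defining series $\tilde\rho$, then $H(M)\subset\widetilde M$ means $\tilde\rho(H(Z),\bar H(\zeta))=c(Z,\zeta)\rho(Z,\zeta)$ for some formal power series $c$. Finite type: a formal $(1,0)$ (resp. $(0,1)$) vector field $X=\sum_j a_j(Z,\zeta)\partial_{Z_j}$ (resp. $X=\sum_j b_j(Z,\zeta)\partial_{\zeta_j}$), with formal power series coefficients, is tangent to $M$ if $X\rho$ lies in the ideal generated by $\rho$. $M$ is of finite type at $0$ if the complex Lie algebra $\mathfrak g_M$ generated by all such fields satisfies $\mathfrak g_M(0)=\mathbb CT_0M:=\{X\in\mathbb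 C^{2N}: d\rho(0)X=0\}$. Normal coordinates for $M$: a formal invertible change $Z=Z(z,w)$, $z\in\mathbb C^n$, $w\in\mathbb C$, with corresponding $\zeta=\bar Z(\chi,\tau)$, such that $\rho(Z(z,w),\bar Z(\chi,\tau))=a(z,w,\chi,\tau)(w-Q(z,\chi,\tau))$ with $a$ an invertible formal power series and $Q\in\mathbb C[[z,\chi,\tau]]$ satisfying $Q(0,\chi,\tau)=Q(z,0,\tau)=\tau$. Such coordinates exist. Choose normal coordinates $(z,w)$ for $M$ and $(\tilde z,\tilde w)$ for $\widetilde M$, and write $H=(F,G)$, $F=F(z,w)\in\mathbb C^n$, $G=G(z,w)\in\mathbb C$, accordingly. $H$ is not totally degenerate at $0$ if $\det\frac{\partial F}{\partial z}(z,0)\not\equiv0$ as a formal power series in $z$. $H$ is CR transversal to $\widetilde M$ at $0$ if $T^{1,0}_0\widetilde M+dH(T^{1,0}_0\mathbb C^N)=T^{1,0}_0\mathbb C^N$, where $T_0^{1,0}\mathbb C^N\cong\mathbb C^N$, $T^{1,0}_0\widetilde M=\{v\in\mathbb C^N:\partial_Z\tilde\rho(0)v=0\}$ and $dH=\partial H/\partial Z(0)$. *)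

theory Defs
  imports "HOL-Analysis.Analysis"
begin

section \<open>Formal power series in finitely many variables\<close>

text \<open>
  \<open>'v mfps\<close> is the ring of formal power series over the complex numbers in variables indexed by
  the finite type \<open>'v\<close>; a monomial is given by its exponents, a function \<open>'v \<Rightarrow> nat\<close>.
\<close>

typedef 'v mfps = "UNIV :: (('v::finite \<Rightarrow> nat) \<Rightarrow> complex) set"
  morphisms mcoeff Abs_mfps
  by simp

lemma mcoeff_Abs [simp]: "mcoeff (Abs_mfps f) = f"
  by (simp add: Abs_mfps_inverse)

lemma mfps_eqI: "(\<And>\<alpha>. mcoeff f \<alpha> = mcoeff g \<alpha>) \<Longrightarrow> f = g"
  by (metis mcoeff_inject ext)

lemma finite_exponents_le [simp]:
  fixes \<alpha> :: "'v::finite \<Rightarrow> nat"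
  shows "finite {..\<alpha>}"
proof -
  have "{..\<alpha>} \<subseteq> PiE UNIV (\<lambda>v. {..\<alpha> v})"
    by (auto simp: le_fun_def)
  then show ?thesis
    by (rule finite_subset) (simp add: finite_PiE)
qed

instantiation mfps :: (finite) comm_ring_1
begin

definition "0 = Abs_mfps (\<lambda>_. 0)"
definition "1 = Abs_mfps (\<lambda>\<alpha>. if \<alpha> = (\<lambda>_. 0) then 1 else 0)"
definition "f + g = Abs_mfps (\<lambda>\<alpha>. mcoeff f \<alpha> + mcoeff g \<alpha>)"
definition "- f = Abs_mfps (\<lambda>\<alpha>. - mcoeff f \<alpha>)"
definition "f - g = Abs_mfps (\<lambda>\<alpha>. mcoeff f \<alpha> - mcoeff g \<alpha>)"
definition "f * g = Abs_mfps (\<lambda>\<alpha>. \<Sum>\<beta>\<le>\<alpha>. mcoeff f \<beta> * mcoeff g (\<lambda>v. \<alpha> v - \<beta> v))"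

instance
proof
  fix f g h :: "'a mfps"
  show "f * g * h = f * (g * h)"
  proof (rule mfps_eqI)
    fix \<alpha> :: "'a \<Rightarrow> nat"
    have "mcoeff (f * g * h) \<alpha> = (\<Sum>(\<beta>, \<gamma>)\<in>(SIGMA \<beta>:{..\<alpha>}. {..\<beta>}).
        mcoeff f \<gamma> * mcoeff g (\<lambda>v. \<beta> v - \<gamma> v) * mcoeff h (\<lambda>v. \<alpha> v - \<beta> v))"
      by (simp add: times_mfps_def sum_distrib_right sum.Sigma)
    also have "\<dots> = (\<Sum>(\<gamma>, \<delta>)\<in>(SIGMA \<gamma>:{..\<alpha>}. {..\<lambda>v. \<alpha> v - \<gamma> v}).
        mcoeff f \<gamma> * (mcoeff g \<delta> * mcoeff h (\<lambda>v. \<alpha> v - \<gamma> v - \<delta> v)))"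
    proof (rule sum.reindex_bij_witness[where i = "\<lambda>(\<gamma>, \<delta>). (\<lambda>v. \<gamma> v + \<delta> v, \<gamma>)"
          and j = "\<lambda>(\<beta>, \<gamma>). (\<gamma>, \<lambda>v. \<beta> v - \<gamma> v)"], goal_cases)
      case (1 x)
      then show ?case by (auto simp: le_fun_def)
    next
      case (2 x)
      then obtain \<beta> \<gamma> where x: "x = (\<beta>, \<gamma>)" "\<And>v. \<beta> v \<le> \<alpha> v" "\<And>v. \<gamma> v \<le> \<beta> v"
        by (auto simp: le_fun_def)
      then show ?case
        by (auto simp: le_fun_def intro: diff_le_mono order_trans[OF x(3) x(2)])
    next
      case (3 x)
      then show ?case by auto
    next
      case (4 x)
      then obtain \<gamma> \<delta> where x: "x = (\<gamma>, \<delta>)" "\<And>v. \<gamma> v \<le> \<alpha> v" "\<And>v. \<delta> v \<le> \<alpha> v - \<gamma> v"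
        by (auto simp: le_fun_def)
      have "\<gamma> v + \<delta> v \<le> \<alpha> v" for v
        using x(2)[of v] x(3)[of v] by linarith
      then show ?case by (simp add: x(1) le_fun_def)
    next
      case (5 x)
      then show ?case by (auto simp: le_fun_def mult.assoc)
    qed
    also have "\<dots> = mcoeff (f * (g * h)) \<alpha>"
      by (simp add: times_mfps_def sum_distrib_left sum.Sigma)
    finally show "mcoeff (f * g * h) \<alpha> = mcoeff (f * (g * h)) \<alpha>" .
  qed
  show "f * g = g * f"
  proof (rule mfps_eqI)
    fix \<alpha> :: "'a \<Rightarrow> nat"
    show "mcoeff (f * g) \<alpha> = mcoeff (g * f) \<alpha>"
      unfolding times_mfps_def mcoeff_Abs
      by (rule sum.reindex_bij_witness[where i = "\<lambda>\<beta> v. \<alpha> v - \<beta> v" and j = "\<lambda>\<beta> v. \<alpha> v - \<beta> v"])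
        (auto simp: le_fun_def)
  qed
  show "1 * f = f"
  proof (rule mfps_eqI)
    fix \<alpha> :: "'a \<Rightarrow> nat"
    have "mcoeff (1 * f) \<alpha> = (\<Sum>\<beta>\<le>\<alpha>. if \<beta> = (\<lambda>_. 0) then mcoeff f \<alpha> else 0)"
      unfolding times_mfps_def one_mfps_def mcoeff_Abs by (rule sum.cong[OF refl]) simp
    also have "\<dots> = mcoeff f \<alpha>"
      by (subst sum.delta) (simp_all add: le_fun_def)
    finally show "mcoeff (1 * f) \<alpha> = mcoeff f \<alpha>" .
  qed
  show "(f + g) * h = f * h + g * h"
    by (simp add: times_mfps_def plus_mfps_def sum.distrib distrib_right)
  show "(0::'a mfps) \<noteq> 1"
  proof
    assume "(0::'a mfps) = 1"
    then have "mcoeff (0::'a mfps) (\<lambda>_. 0) = mcoeff 1 (\<lambda>_. 0)" by simp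
    then show False by (simp add: zero_mfps_def one_mfps_def)
  qed
qed (simp_all add: zero_mfps_def plus_mfps_def uminus_mfps_def minus_mfps_def mcoeff_inverse add_ac)

end

definition const_coeff :: "'v::finite mfps \<Rightarrow> complex" where
  "const_coeff f = mcoeff f (\<lambda>_. 0)"

definition Var :: "'v::finite \<Rightarrow> 'v mfps" where
  "Var v = Abs_mfps (\<lambda>\<alpha>. if \<alpha> = (\<lambda>u. if u = v then 1 else 0) then 1 else 0)"

definition scale :: "complex \<Rightarrow> 'v::finite mfps \<Rightarrow> 'v mfps" where
  "scale c f = Abs_mfps (\<lambda>\<alpha>. c * mcoeff f \<alpha>)"

definition conj_series :: "'v::finite mfps \<Rightarrow> 'v mfps" where
  "conj_series f = Abs_mfps (\<lambda>\<alpha>. cnj (mcoeff f \<alpha>))"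

definition pdiff :: "'v::finite \<Rightarrow> 'v mfps \<Rightarrow> 'v mfps" where
  "pdiff v f = Abs_mfps (\<lambda>\<alpha>. of_nat (Suc (\<alpha> v)) * mcoeff f (\<alpha>(v := Suc (\<alpha> v))))"

text \<open>
  \<open>subst f g\<close> is \<open>f(g)\<close>, i.e. the sum of \<open>mcoeff f \<alpha>\<close> times \<open>g\<^sup>\<alpha>\<close> over all \<open>\<alpha>\<close>. It is only meant for
  \<open>g\<close> without constant terms; then \<open>g\<^sup>\<alpha>\<close> has order at least \<open>\<bar>\<alpha>\<bar>\<close>, so that only the finitely many
  \<open>\<alpha>\<close> with \<open>\<bar>\<alpha>\<bar> \<le> \<bar>\<beta>\<bar>\<close> contribute to the coefficient at \<open>\<beta>\<close>.
\<close>

definition subst :: "'v::finite mfps \<Rightarrow> ('v \<Rightarrow> 'u::finite mfps) \<Rightarrow> 'u mfps" where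
  "subst f g = Abs_mfps (\<lambda>\<beta>. \<Sum>\<alpha> | sum \<alpha> UNIV \<le> sum \<beta> UNIV.
     mcoeff f \<alpha> * mcoeff (\<Prod>v\<in>UNIV. g v ^ \<alpha> v) \<beta>)"

lemma finite_exponents_degree_le:
  "finite {\<alpha> :: 'v::finite \<Rightarrow> nat. sum \<alpha> UNIV \<le> d}"
proof -
  have "{\<alpha> :: 'v \<Rightarrow> nat. sum \<alpha> UNIV \<le> d} \<subseteq> {..\<lambda>_. d}"
  proof
    fix \<alpha> :: "'v \<Rightarrow> nat"
    assume "\<alpha> \<in> {\<alpha>. sum \<alpha> UNIV \<le> d}"
    moreover have "\<alpha> v \<le> sum \<alpha> UNIV" for v
      by (rule member_le_sum) auto
    ultimately show "\<alpha> \<in> {..\<lambda>_. d}"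
      by (auto simp: le_fun_def intro: order_trans)
  qed
  then show ?thesis
    by (rule finite_subset) simp
qed

definition depends_not_on :: "'v::finite mfps \<Rightarrow> 'v \<Rightarrow> bool" where
  "depends_not_on f v \<longleftrightarrow> (\<forall>\<alpha>. \<alpha> v \<noteq> 0 \<longrightarrow> mcoeff f \<alpha> = 0)"


section \<open>Formal mappings and formal real hypersurfaces\<close>

text \<open>
  The coordinates of complex \<open>N\<close>-space are indexed by the finite type \<open>'N\<close>. Series in \<open>(Z, \<zeta>)\<close> have
  type \<open>('N + 'N) mfps\<close>, where \<open>Var (Inl j)\<close> is \<open>Z\<^sub>j\<close> and \<open>Var (Inr j)\<close> is \<open>\<zeta>\<^sub>j\<close>.
\<close>

type_synonym 'N map_series = "'N \<Rightarrow> 'N mfps"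

definition formal_mapping :: "'N::finite map_series \<Rightarrow> bool" where
  "formal_mapping H \<longleftrightarrow> (\<forall>j. const_coeff (H j) = 0)"

definition comp_map :: "'N::finite map_series \<Rightarrow> 'N map_series \<Rightarrow> 'N map_series" where
  "comp_map H K = (\<lambda>j. subst (H j) K)"

definition formal_change :: "'N::finite map_series \<Rightarrow> bool" where
  "formal_change \<Phi> \<longleftrightarrow> formal_mapping \<Phi> \<and>
     (\<exists>\<Psi>. formal_mapping \<Psi> \<and> comp_map \<Phi> \<Psi> = Var \<and> comp_map \<Psi> \<Phi> = Var)"

text \<open>\<open>complexify H\<close> is the mapping \<open>(Z, \<zeta>) \<mapsto> (H(Z), \<bar>H(\<zeta>))\<close>, where \<open>\<bar>H\<close> is the conjugate series.\<close>

definition complexify :: "'N::finite map_series \<Rightarrow> ('N + 'N) map_series" where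
  "complexify H = case_sum
     (\<lambda>j. subst (H j) (\<lambda>l. Var (Inl l)))
     (\<lambda>j. subst (conj_series (H j)) (\<lambda>l. Var (Inr l)))"

definition swap_vars :: "('N::finite + 'N) map_series" where
  "swap_vars = case_sum (\<lambda>j. Var (Inr j)) (\<lambda>j. Var (Inl j))"

definition formal_real_hypersurface :: "('N::finite + 'N) mfps \<Rightarrow> bool" where
  "formal_real_hypersurface \<rho> \<longleftrightarrow>
     const_coeff \<rho> = 0 \<and> \<rho> = subst (conj_series \<rho>) swap_vars \<and>
     (\<exists>v. const_coeff (pdiff v \<rho>) \<noteq> 0)"

definition maps_into :: "'N::finite map_series \<Rightarrow> ('N + 'N) mfps \<Rightarrow> ('N + 'N) mfps \<Rightarrow> bool" where
  "maps_into H \<rho> \<rho>' \<longleftrightarrow> (\<exists>c. subst \<rho>' (complexify H) = c * \<rho>)"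


section \<open>Finite type\<close>

text \<open>A vector field is given by its coefficients with respect to the coordinate fields.\<close>

type_synonym 'v vfield = "'v \<Rightarrow> 'v mfps"

definition apply_vf :: "'v::finite vfield \<Rightarrow> 'v mfps \<Rightarrow> 'v mfps" where
  "apply_vf X f = (\<Sum>v\<in>UNIV. X v * pdiff v f)"

definition bracket :: "'v::finite vfield \<Rightarrow> 'v vfield \<Rightarrow> 'v vfield" where
  "bracket X Y = (\<lambda>v. apply_vf X (Y v) - apply_vf Y (X v))"

definition tangent_vf :: "'v::finite mfps \<Rightarrow> 'v vfield \<Rightarrow> bool" where
  "tangent_vf \<rho> X \<longleftrightarrow> \<rho> dvd apply_vf X \<rho>"

definition type_1_0 :: "('N::finite + 'N) vfield \<Rightarrow> bool" where
  "type_1_0 X \<longleftrightarrow> (\<forall>j. X (Inr j) = 0)"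

definition type_0_1 :: "('N::finite + 'N) vfield \<Rightarrow> bool" where
  "type_0_1 X \<longleftrightarrow> (\<forall>j. X (Inl j) = 0)"

inductive_set lie_algebra_gen :: "'v::finite vfield set \<Rightarrow> 'v vfield set" for S where
  base: "X \<in> S \<Longrightarrow> X \<in> lie_algebra_gen S"
| zero: "(\<lambda>_. 0) \<in> lie_algebra_gen S"
| add: "X \<in> lie_algebra_gen S \<Longrightarrow> Y \<in> lie_algebra_gen S \<Longrightarrow> (\<lambda>v. X v + Y v) \<in> lie_algebra_gen S"
| scale: "X \<in> lie_algebra_gen S \<Longrightarrow> (\<lambda>v. scale c (X v)) \<in> lie_algebra_gen S"
| bracket: "X \<in> lie_algebra_gen S \<Longrightarrow> Y \<in> lie_algebra_gen S \<Longrightarrow> bracket X Y \<in> lie_algebra_gen S"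

definition CR_lie_algebra :: "('N::finite + 'N) mfps \<Rightarrow> ('N + 'N) vfield set" where
  "CR_lie_algebra \<rho> = lie_algebra_gen {X. (type_1_0 X \<or> type_0_1 X) \<and> tangent_vf \<rho> X}"

definition complex_tangent_space :: "('N::finite + 'N) mfps \<Rightarrow> (complex ^ ('N + 'N)) set" where
  "complex_tangent_space \<rho> = {x. (\<Sum>v\<in>UNIV. const_coeff (pdiff v \<rho>) * x $ v) = 0}"

definition finite_type :: "('N::finite + 'N) mfps \<Rightarrow> bool" where
  "finite_type \<rho> \<longleftrightarrow>
     (\<lambda>X. \<chi> v. const_coeff (X v)) ` CR_lie_algebra \<rho> = complex_tangent_space \<rho>"


section \<open>Normal coordinates and total degeneracy\<close>

text \<open>
  Normal coordinates \<open>(z, w)\<close> are indexed by the same type \<open>'N\<close>: the coordinate with index \<open>k\<close> is \<open>w\<close>,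
  and the remaining \<open>n = N - 1\<close> ones are \<open>z\<close>. (This allows \<open>n = 0\<close>, unlike an index type \<open>'n option\<close>.)
  Correspondingly \<open>Inr k\<close> is the index of \<open>\<tau>\<close>, and \<open>Inr j\<close> with \<open>j \<noteq> k\<close> is that of \<open>\<chi>\<^sub>j\<close>.
\<close>

definition normal_Q :: "'N::finite \<Rightarrow> ('N + 'N) mfps \<Rightarrow> bool" where
  "normal_Q k Q \<longleftrightarrow> depends_not_on Q (Inl k) \<and>
     subst Q (case_sum (\<lambda>j. if j = k then Var (Inl j) else 0) (\<lambda>j. Var (Inr j))) = Var (Inr k) \<and>
     subst Q (case_sum (\<lambda>j. Var (Inl j)) (\<lambda>j. if j = k then Var (Inr j) else 0)) = Var (Inr k)"

definition normal_coordinates :: "'N::finite \<Rightarrow> ('N + 'N) mfps \<Rightarrow> 'N map_series \<Rightarrow> bool" where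
  "normal_coordinates k \<rho> \<Phi> \<longleftrightarrow> formal_change \<Phi> \<and>
     (\<exists>a Q. a dvd 1 \<and> normal_Q k Q \<and> subst \<rho> (complexify \<Phi>) = a * (Var (Inl k) - Q))"

text \<open>
  \<open>K\<close> is the expression of \<open>H\<close> in the source coordinates \<open>\<Phi>\<close> and the target coordinates \<open>\<Phi>'\<close>:
  the unique formal mapping \<open>\<Phi>'\<^sup>-\<^sup>1 \<circ> H \<circ> \<Phi>\<close>. Its components with index \<open>j \<noteq> k\<close> form \<open>F\<close>, and \<open>K k\<close> is \<open>G\<close>.
\<close>

definition in_coordinates ::
  "'N::finite map_series \<Rightarrow> 'N map_series \<Rightarrow> 'N map_series \<Rightarrow> 'N map_series \<Rightarrow> bool" where
  "in_coordinates \<Phi> \<Phi>' H K \<longleftrightarrow> formal_mapping K \<and> comp_map \<Phi>' K = comp_map H \<Phi>"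

text \<open>
  The determinant of a square matrix indexed by a set \<open>I\<close>, which may be empty, by the Leibniz formula.
\<close>

definition det_on :: "'i set \<Rightarrow> ('i \<Rightarrow> 'i \<Rightarrow> 'a::comm_ring_1) \<Rightarrow> 'a" where
  "det_on I A = (\<Sum>p | p permutes I. of_int (sign p) * (\<Prod>i\<in>I. A i (p i)))"

lemma det_on_UNIV: "det_on UNIV (\<lambda>i j. A $ i $ j) = det A"
  by (simp add: det_on_def det_def)

definition not_totally_degenerate :: "'N::finite \<Rightarrow> 'N map_series \<Rightarrow> bool" where
  "not_totally_degenerate k K \<longleftrightarrow>
     subst (det_on (- {k}) (\<lambda>i j. pdiff j (K i))) (\<lambda>j. if j = k then 0 else Var j) \<noteq> 0"


section \<open>CR transversality\<close>

definition holo_tangent_space :: "('N::finite + 'N) mfps \<Rightarrow> (complex ^ 'N) set" where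
  "holo_tangent_space \<rho> = {v. (\<Sum>j\<in>UNIV. const_coeff (pdiff (Inl j) \<rho>) * v $ j) = 0}"

definition differential_at_0 :: "'N::finite map_series \<Rightarrow> complex ^ 'N ^ 'N" where
  "differential_at_0 H = (\<chi> i j. const_coeff (pdiff j (H i)))"

definition CR_transversal :: "'N::finite map_series \<Rightarrow> ('N + 'N) mfps \<Rightarrow> bool" where
  "CR_transversal H \<rho>' \<longleftrightarrow>
     {x + y | x y. x \<in> holo_tangent_space \<rho>' \<and> y \<in> range ((*v) (differential_at_0 H))} = UNIV"

end

theory Submission
  imports Defs
begin

text \<open>
  In normal coordinates \<open>H\<close> is a map \<open>K = (F, G)\<close>. Write \<open>w = Q(z, \<chi>, \<tau>)\<close> for the source and
  \<open>w = R(z, \<chi>, \<tau>)\<close> for the target. The mapping condition becomes, after substituting \<open>w = Q\<close>,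
    \<open>G(z, Q) = R(F(z, Q), \<bar>F(\<chi>, \<tau>), \<bar>G(\<chi>, \<tau>))\<close>,
  and transversality means \<open>G\<^sub>w(0) \<noteq> 0\<close>, since \<open>G(z, 0) = 0\<close>
  (lemma \<open>CR_transversal_in_normal_coordinates\<close>).

  Differentiating this identity in \<open>\<chi>\<close> and \<open>\<tau>\<close> and then setting \<open>\<tau> = 0\<close> gives a linear system. Put
  \<open>D = G\<^sub>w - R\<^sub>z F\<^sub>w\<close>, \<open>r = R\<^sub>\<chi>\<close>, \<open>u = R\<^sub>\<tau>\<close> (all at the mapped point), \<open>\<theta> = Q(z, \<chi>, 0)\<close> and
  \<open>g = \<bar>G\<^sub>\<tau>(\<chi>, 0)\<close>. Then
    \<open>D \<theta>\<^sub>\<chi> = r \<bar>F\<^sub>\<chi>(\<chi>, 0)\<close> and \<open>D Q\<^sub>\<tau> = r \<bar>F\<^sub>\<tau>(\<chi>, 0) + g u\<close>.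
  Eliminating \<open>r\<close> by the adjugate of \<open>\<bar>F\<^sub>\<chi>(\<chi>, 0)\<close>, whose determinant \<open>\<delta>\<close> is nonzero because \<open>H\<close> is not
  totally degenerate, leaves
    \<open>D P = \<delta> g u\<close>, where \<open>P(0, \<chi>) = \<delta>(\<chi>) \<noteq> 0\<close>.

  If \<open>g = 0\<close>, then \<open>D = 0\<close> and hence \<open>r = 0\<close>. Now \<open>r\<close> is \<open>R\<^sub>\<chi>(z, \<chi>, 0)\<close> composed with
  \<open>(z, \<chi>) \<mapsto> (F(z, \<theta>), \<bar>F(\<chi>, 0))\<close>. The Jacobian determinant of this map does not vanish identically, so that
  composition with it is injective (lemma \<open>subst_injective_if_Jacobian_nondegenerate\<close>). Thus
  \<open>R\<^sub>\<chi>(z, \<chi>, 0) = 0\<close> and \<open>R(z, \<chi>, 0) = R(z, 0, 0) = 0\<close>. But then every CR field of the target is tangent to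
  \<open>w = \<tau> = 0\<close>, which contradicts finite type (lemma \<open>finite_type_normal_Q_nonzero\<close>).

  If \<open>g \<noteq> 0\<close>, then \<open>D\<close> divides the product of a unit with \<open>\<delta> g\<close>, a nonzero series in \<open>\<chi>\<close> alone, while
  \<open>D(z, 0) = G\<^sub>w(z, 0) \<noteq> 0\<close>. Comparison of leading exponents for a lexicographic order that ranks \<open>\<chi>\<close> above
  \<open>z\<close> shows that \<open>D\<close> is a unit (lemma \<open>divisor_of_partial_series\<close>), so \<open>G\<^sub>w(0) = D(0) \<noteq> 0\<close>.
\<close>

section \<open>Order of vanishing and density of polynomials\<close>

lemma mcoeff_zero [simp]: "mcoeff 0 \<alpha> = 0"
  by (simp add: zero_mfps_def)

lemma mcoeff_one: "mcoeff 1 \<alpha> = (if \<alpha> = (\<lambda>_. 0) then 1 else 0)"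
  by (simp add: one_mfps_def)

lemma mcoeff_add [simp]: "mcoeff (f + g) \<alpha> = mcoeff f \<alpha> + mcoeff g \<alpha>"
  by (simp add: plus_mfps_def)

lemma mcoeff_uminus [simp]: "mcoeff (- f) \<alpha> = - mcoeff f \<alpha>"
  by (simp add: uminus_mfps_def)

lemma mcoeff_diff [simp]: "mcoeff (f - g) \<alpha> = mcoeff f \<alpha> - mcoeff g \<alpha>"
  by (simp add: minus_mfps_def)

lemma mcoeff_mult: "mcoeff (f * g) \<alpha> = (\<Sum>\<beta>\<le>\<alpha>. mcoeff f \<beta> * mcoeff g (\<lambda>v. \<alpha> v - \<beta> v))"
  by (simp add: times_mfps_def)

lemma mcoeff_sum [simp]: "mcoeff (sum f A) \<alpha> = (\<Sum>a\<in>A. mcoeff (f a) \<alpha>)"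
  by (induction A rule: infinite_finite_induct) auto

lemma mcoeff_scale [simp]: "mcoeff (scale c f) \<alpha> = c * mcoeff f \<alpha>"
  by (simp add: scale_def)

lemma mcoeff_conj_series [simp]: "mcoeff (conj_series f) \<alpha> = cnj (mcoeff f \<alpha>)"
  by (simp add: conj_series_def)

lemma mcoeff_pdiff: "mcoeff (pdiff v f) \<alpha> = of_nat (Suc (\<alpha> v)) * mcoeff f (\<alpha>(v := Suc (\<alpha> v)))"
  by (simp add: pdiff_def)

lemma scale_mult: "scale c f * g = scale c (f * g)"
  by (rule mfps_eqI) (simp add: mcoeff_mult sum_distrib_left mult.assoc)

lemma mult_scale: "f * scale c g = scale c (f * g)"
  by (metis mult.commute scale_mult)

lemma scale_add: "scale c (f + g) = scale c f + scale c g"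
  by (rule mfps_eqI) (simp add: distrib_left)

lemma scale_sum: "scale c (sum f A) = (\<Sum>a\<in>A. scale c (f a))"
  by (rule mfps_eqI) (simp add: sum_distrib_left)

lemma scale_0 [simp]: "scale c 0 = 0"
  by (rule mfps_eqI) simp

definition vanishes_below :: "nat \<Rightarrow> 'v::finite mfps \<Rightarrow> bool" where
  "vanishes_below d f \<longleftrightarrow> (\<forall>\<alpha>. sum \<alpha> UNIV < d \<longrightarrow> mcoeff f \<alpha> = 0)"

lemma vanishes_below_0 [simp]: "vanishes_below 0 f"
  by (simp add: vanishes_below_def)

lemma vanishes_below_1_iff: "vanishes_below (Suc 0) f \<longleftrightarrow> const_coeff f = 0"
proof -
  have "sum \<alpha> UNIV < Suc 0 \<longleftrightarrow> \<alpha> = (\<lambda>_. 0)" for \<alpha> :: "'a \<Rightarrow> nat"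
    by (auto simp: fun_eq_iff)
  then show ?thesis
    by (auto simp: vanishes_below_def const_coeff_def)
qed

lemma vanishes_below_mono: "vanishes_below d f \<Longrightarrow> e \<le> d \<Longrightarrow> vanishes_below e f"
  by (simp add: vanishes_below_def)

lemma vanishes_below_add: "vanishes_below d f \<Longrightarrow> vanishes_below d g \<Longrightarrow> vanishes_below d (f + g)"
  by (simp add: vanishes_below_def)

lemma vanishes_below_diff: "vanishes_below d f \<Longrightarrow> vanishes_below d g \<Longrightarrow> vanishes_below d (f - g)"
  by (simp add: vanishes_below_def)

lemma vanishes_below_sum: "(\<And>a. a \<in> A \<Longrightarrow> vanishes_below d (f a)) \<Longrightarrow> vanishes_below d (sum f A)"
  by (auto simp: vanishes_below_def intro: sum.neutral)

lemma vanishes_below_mult: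
  assumes "vanishes_below d f" "vanishes_below e g"
  shows "vanishes_below (d + e) (f * g)"
  unfolding vanishes_below_def
proof (intro allI impI)
  fix \<alpha> :: "'a \<Rightarrow> nat"
  assume \<alpha>: "sum \<alpha> UNIV < d + e"
  have "mcoeff f \<beta> * mcoeff g (\<lambda>v. \<alpha> v - \<beta> v) = 0" if "\<beta> \<le> \<alpha>" for \<beta>
  proof -
    have "sum \<alpha> UNIV = (\<Sum>v\<in>UNIV. \<beta> v + (\<alpha> v - \<beta> v))"
      using that by (intro sum.cong) (auto simp: le_fun_def)
    then have "sum \<alpha> UNIV = sum \<beta> UNIV + (\<Sum>v\<in>UNIV. \<alpha> v - \<beta> v)"
      by (simp add: sum.distrib)
    then have "sum \<beta> UNIV < d \<or> (\<Sum>v\<in>UNIV. \<alpha> v - \<beta> v) < e"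
      using \<alpha> by linarith
    then show ?thesis
      using assms by (auto simp: vanishes_below_def)
  qed
  then show "mcoeff (f * g) \<alpha> = 0"
    unfolding mcoeff_mult by (intro sum.neutral) auto
qed

lemma vanishes_below_mult_left: "vanishes_below d g \<Longrightarrow> vanishes_below d (f * g)"
  using vanishes_below_mult[of 0 f d g] by simp

lemma vanishes_below_mult_right: "vanishes_below d f \<Longrightarrow> vanishes_below d (f * g)"
  using vanishes_below_mult[of d f 0 g] by simp

lemma vanishes_below_power:
  assumes "vanishes_below 1 f"
  shows "vanishes_below n (f ^ n)"
proof (induction n)
  case (Suc n)
  then show ?case
    using vanishes_below_mult[OF assms, of n "f ^ n"] by simp
qed simp

lemma vanishes_below_prod:
  assumes "finite A" "\<And>a. a \<in> A \<Longrightarrow> vanishes_below (d a) (f a)"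
  shows "vanishes_below (sum d A) (prod f A)"
  using assms by (induction A rule: finite_induct) (auto intro: vanishes_below_mult)

lemma eq_if_vanishes_below: "(\<And>d. vanishes_below d (f - g)) \<Longrightarrow> f = g"
  by (rule mfps_eqI) (metis lessI mcoeff_diff right_minus_eq vanishes_below_def)

lemma vanishes_below_pdiff: "vanishes_below (Suc d) f \<Longrightarrow> vanishes_below d (pdiff v f)"
  unfolding vanishes_below_def
proof (intro allI impI)
  fix \<alpha> :: "'a \<Rightarrow> nat"
  assume f: "\<forall>\<alpha>. sum \<alpha> UNIV < Suc d \<longrightarrow> mcoeff f \<alpha> = 0" and "sum \<alpha> UNIV < d"
  have "sum (\<alpha>(v := Suc (\<alpha> v))) UNIV = Suc (sum \<alpha> UNIV)"
    by (subst (1 2) sum.remove[of UNIV v]) (auto intro!: sum.cong)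
  then show "mcoeff (pdiff v f) \<alpha> = 0"
    using f \<open>sum \<alpha> UNIV < d\<close> by (simp add: mcoeff_pdiff)
qed

definition monomial :: "('v::finite \<Rightarrow> nat) \<Rightarrow> 'v mfps" where
  "monomial \<alpha> = Abs_mfps (\<lambda>\<beta>. if \<beta> = \<alpha> then 1 else 0)"

lemma mcoeff_monomial: "mcoeff (monomial \<alpha>) \<beta> = (if \<beta> = \<alpha> then 1 else 0)"
  by (simp add: monomial_def)

lemma monomial_0: "monomial (\<lambda>_. 0) = 1"
  by (simp add: monomial_def one_mfps_def)

lemma Var_eq_monomial: "Var v = monomial (\<lambda>u. if u = v then 1 else 0)"
  by (simp add: Var_def monomial_def)

lemma monomial_mult: "monomial \<alpha> * monomial \<beta> = monomial (\<lambda>v. \<alpha> v + \<beta> v)"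
proof (rule mfps_eqI)
  fix \<delta> :: "'a \<Rightarrow> nat"
  have "mcoeff (monomial \<alpha> * monomial \<beta>) \<delta> =
      (\<Sum>\<gamma>\<le>\<delta>. if \<gamma> = \<alpha> then (if (\<lambda>v. \<delta> v - \<alpha> v) = \<beta> then 1 else 0) else 0)"
    unfolding mcoeff_mult by (rule sum.cong) (auto simp: mcoeff_monomial)
  also have "\<dots> = (if \<alpha> \<le> \<delta> \<and> (\<lambda>v. \<delta> v - \<alpha> v) = \<beta> then 1 else 0)"
    by (subst sum.delta) auto
  also have "\<dots> = mcoeff (monomial (\<lambda>v. \<alpha> v + \<beta> v)) \<delta>"
    by (auto simp: mcoeff_monomial le_fun_def)
  finally show "mcoeff (monomial \<alpha> * monomial \<beta>) \<delta> = mcoeff (monomial (\<lambda>v. \<alpha> v + \<beta> v)) \<delta>" .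
qed

lemma Var_power: "Var v ^ n = monomial (\<lambda>u. if u = v then n else 0)"
proof (induction n)
  case (Suc n)
  have "(\<lambda>u. (if u = v then 1 else 0) + (if u = v then n else 0)) = (\<lambda>u. if u = v then Suc n else 0)"
    by auto
  with Suc show ?case
    by (simp add: Var_eq_monomial monomial_mult)
qed (simp add: monomial_0)

lemma monomial_eq_prod: "monomial \<alpha> = (\<Prod>v\<in>UNIV. Var v ^ \<alpha> v)"
proof -
  have "(\<Prod>v\<in>A. Var v ^ \<alpha> v) = monomial (\<lambda>u. if u \<in> A then \<alpha> u else 0)" if "finite A" for A
    using that
  proof (induction A rule: finite_induct)
    case (insert v A)
    have "(\<lambda>u. (if u = v then \<alpha> v else 0) + (if u \<in> A then \<alpha> u else 0)) =
        (\<lambda>u. if u \<in> insert v A then \<alpha> u else 0)"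
      using insert.hyps by auto
    with insert show ?case
      by (simp add: Var_power monomial_mult)
  qed (simp add: monomial_0)
  from this[of UNIV] show ?thesis by simp
qed

lemma truncation_vanishes_below:
  "vanishes_below d (f - (\<Sum>\<alpha> | sum \<alpha> UNIV \<le> d. scale (mcoeff f \<alpha>) (monomial \<alpha>)))"
  unfolding vanishes_below_def
proof (intro allI impI)
  fix \<beta> :: "'a \<Rightarrow> nat"
  assume "sum \<beta> UNIV < d"
  moreover have "(\<Sum>\<alpha> | sum \<alpha> UNIV \<le> d. mcoeff f \<alpha> * (if \<beta> = \<alpha> then 1 else 0)) =
      (\<Sum>\<alpha> | sum \<alpha> UNIV \<le> d. if \<alpha> = \<beta> then mcoeff f \<beta> else 0)"
    by (rule sum.cong) auto
  ultimately show "mcoeff (f - (\<Sum>\<alpha> | sum \<alpha> UNIV \<le> d. scale (mcoeff f \<alpha>) (monomial \<alpha>))) \<beta> = 0"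
    by (simp add: mcoeff_monomial sum.delta finite_exponents_degree_le)
qed

text \<open>
  Polynomials are dense, so two additive maps that are continuous for the topology given by the order
  of vanishing agree as soon as they agree on monomials. The shift \<open>e\<close> admits derivations, which lower
  the order by one.
\<close>

lemma additive_continuous_eqI:
  fixes L L' :: "'v::finite mfps \<Rightarrow> 'u::finite mfps"
  assumes add: "\<And>f g. L (f + g) = L f + L g" "\<And>f g. L' (f + g) = L' f + L' g"
    and cont: "\<And>d f. vanishes_below (d + e) f \<Longrightarrow> vanishes_below d (L f)"
      "\<And>d f. vanishes_below (d + e) f \<Longrightarrow> vanishes_below d (L' f)"
    and eq: "\<And>c \<alpha>. L (scale c (monomial \<alpha>)) = L' (scale c (monomial \<alpha>))"
  shows "L f = L' f"
proof (rule eq_if_vanishes_below)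
  fix d
  have zero: "L 0 = 0" "L' 0 = 0"
    using add(1)[of 0 0] add(2)[of 0 0] by simp_all
  define A :: "('v \<Rightarrow> nat) set" where "A = {\<alpha>. sum \<alpha> UNIV \<le> d + e}"
  define p where "p = (\<Sum>\<alpha>\<in>A. scale (mcoeff f \<alpha>) (monomial \<alpha>))"
  have "L (sum h B) = (\<Sum>b\<in>B. L (h b))" "L' (sum h B) = (\<Sum>b\<in>B. L' (h b))"
    if "finite B" for h :: "('v \<Rightarrow> nat) \<Rightarrow> 'v mfps" and B
    using that by (induction B rule: finite_induct) (simp_all add: add zero)
  then have p: "L p = L' p"
    unfolding p_def A_def by (simp add: eq finite_exponents_degree_le)
  have rest: "vanishes_below (d + e) (f - p)"
    unfolding p_def A_def by (rule truncation_vanishes_below)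
  have "vanishes_below d (L (f - p) - L' (f - p))"
    by (rule vanishes_below_diff[OF cont(1)[OF rest] cont(2)[OF rest]])
  also have "L (f - p) - L' (f - p) = L f - L' f"
    using add(1)[of "f - p" p] add(2)[of "f - p" p] p by simp
  finally show "vanishes_below d (L f - L' f)" .
qed

section \<open>Substitution, conjugation and derivatives\<close>

lemma mcoeff_subst: "mcoeff (subst f g) \<beta> = (\<Sum>\<alpha> | sum \<alpha> UNIV \<le> sum \<beta> UNIV.
     mcoeff f \<alpha> * mcoeff (\<Prod>v\<in>UNIV. g v ^ \<alpha> v) \<beta>)"
  by (simp add: subst_def)

lemma subst_add: "subst (f + h) g = subst f g + subst h g"
  by (rule mfps_eqI) (simp add: mcoeff_subst distrib_right sum.distrib)

lemma subst_diff: "subst (f - h) g = subst f g - subst h g"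
  by (rule mfps_eqI) (simp add: mcoeff_subst left_diff_distrib sum_subtractf)

lemma subst_scale: "subst (scale c f) g = scale c (subst f g)"
  by (rule mfps_eqI) (simp add: mcoeff_subst sum_distrib_left mult.assoc)

lemma subst_zero [simp]: "subst 0 g = 0"
  by (rule mfps_eqI) (simp add: mcoeff_subst)

lemma subst_uminus: "subst (- f) g = - subst f g"
  using subst_diff[of 0 f g] by simp

lemma subst_sum: "subst (sum f A) g = (\<Sum>a\<in>A. subst (f a) g)"
  by (induction A rule: infinite_finite_induct) (simp_all add: subst_add)

lemma const_coeff_subst [simp]:
  fixes f :: "'v::finite mfps"
  shows "const_coeff (subst f g) = const_coeff f"
proof -
  have "{\<alpha>. \<forall>v. \<alpha> v = 0} = {\<lambda>_::'v. 0::nat}"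
    by (auto simp: fun_eq_iff)
  then show ?thesis
    by (simp add: const_coeff_def mcoeff_subst mcoeff_one)
qed

lemma vanishes_below_subst: "vanishes_below d f \<Longrightarrow> vanishes_below d (subst f g)"
  by (auto simp: vanishes_below_def mcoeff_subst intro!: sum.neutral)

lemma subst_scale_monomial:
  assumes "\<And>v. const_coeff (g v) = 0"
  shows "subst (scale c (monomial \<alpha>)) g = scale c (\<Prod>v\<in>UNIV. g v ^ \<alpha> v)"
proof (rule mfps_eqI)
  fix \<beta> :: "'b \<Rightarrow> nat"
  have "vanishes_below (sum \<alpha> UNIV) (\<Prod>v\<in>UNIV. g v ^ \<alpha> v)"
    using assms by (intro vanishes_below_prod vanishes_below_power) (auto simp: vanishes_below_1_iff)
  then have "sum \<beta> UNIV < sum \<alpha> UNIV \<Longrightarrow> mcoeff (\<Prod>v\<in>UNIV. g v ^ \<alpha> v) \<beta> = 0"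
    by (simp add: vanishes_below_def)
  moreover have "mcoeff (subst (scale c (monomial \<alpha>)) g) \<beta> = (\<Sum>\<gamma> | sum \<gamma> UNIV \<le> sum \<beta> UNIV.
      if \<gamma> = \<alpha> then c * mcoeff (\<Prod>v\<in>UNIV. g v ^ \<alpha> v) \<beta> else 0)"
    unfolding mcoeff_subst by (rule sum.cong) (auto simp: mcoeff_monomial)
  ultimately show "mcoeff (subst (scale c (monomial \<alpha>)) g) \<beta> = mcoeff (scale c (\<Prod>v\<in>UNIV. g v ^ \<alpha> v)) \<beta>"
    by (auto simp: finite_exponents_degree_le)
qed

lemma scale_1 [simp]: "scale 1 f = f"
  by (rule mfps_eqI) simp

lemma subst_monomial:
  assumes "\<And>v. const_coeff (g v) = 0"
  shows "subst (monomial \<alpha>) g = (\<Prod>v\<in>UNIV. g v ^ \<alpha> v)"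
  using subst_scale_monomial[OF assms, of 1 \<alpha>] by simp

lemma subst_one [simp]:
  fixes g :: "'v::finite \<Rightarrow> 'u::finite mfps"
  shows "subst 1 g = 1"
proof (rule mfps_eqI)
  fix \<beta> :: "'u \<Rightarrow> nat"
  have "mcoeff (subst 1 g) \<beta> = (\<Sum>\<gamma>::'v \<Rightarrow> nat | sum \<gamma> UNIV \<le> sum \<beta> UNIV.
      if \<gamma> = (\<lambda>_. 0) then mcoeff 1 \<beta> else 0)"
    unfolding mcoeff_subst by (rule sum.cong) (auto simp: mcoeff_one)
  then show "mcoeff (subst 1 g) \<beta> = mcoeff 1 \<beta>"
    by (simp add: finite_exponents_degree_le)
qed

lemma subst_of_int [simp]: "subst (of_int z) g = of_int z"
proof -
  have nat: "subst (of_nat n) g = of_nat n" for n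
    by (induction n) (simp_all add: subst_add)
  show ?thesis
    by (cases z rule: int_cases2) (simp_all add: nat subst_uminus)
qed

lemma subst_Var [simp]:
  assumes "\<And>v. const_coeff (g v) = 0"
  shows "subst (Var v) g = g v"
proof -
  have "subst (Var v) g = (\<Prod>u\<in>UNIV. if u = v then g v else 1)"
    unfolding Var_eq_monomial subst_monomial[OF assms] by (rule prod.cong) auto
  then show ?thesis by simp
qed

text \<open>
  Both sides are additive and continuous in each factor, so it suffices to treat two monomials.
\<close>

lemma subst_mult:
  assumes g: "\<And>v. const_coeff (g v) = 0"
  shows "subst (f * h) g = subst f g * subst h g"
proof -
  have monomial: "subst (scale c (monomial \<alpha>) * scale d (monomial \<beta>)) g =
      subst (scale c (monomial \<alpha>)) g * subst (scale d (monomial \<beta>)) g" for c d \<alpha> \<beta>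
    by (simp add: scale_mult mult_scale monomial_mult subst_scale subst_monomial[OF g] power_add prod.distrib)
  have "subst (f * scale d (monomial \<beta>)) g = subst f g * subst (scale d (monomial \<beta>)) g" for d \<beta>
    by (rule additive_continuous_eqI[where e = 0 and f = f and L = "\<lambda>f. subst (f * scale d (monomial \<beta>)) g"
          and L' = "\<lambda>f. subst f g * subst (scale d (monomial \<beta>)) g"])
      (simp_all add: subst_add distrib_right vanishes_below_subst vanishes_below_mult_right monomial)
  then show ?thesis
    by (intro additive_continuous_eqI[where e = 0 and f = h and L = "\<lambda>h. subst (f * h) g"
          and L' = "\<lambda>h. subst f g * subst h g"])
      (simp_all add: subst_add distrib_left vanishes_below_subst vanishes_below_mult_left)
qed

lemma subst_prod:
  assumes "\<And>v. const_coeff (g v) = 0"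
  shows "subst (prod f A) g = (\<Prod>a\<in>A. subst (f a) g)"
  by (induction A rule: infinite_finite_induct) (simp_all add: subst_mult[OF assms])

lemma subst_power:
  assumes "\<And>v. const_coeff (g v) = 0"
  shows "subst (f ^ n) g = subst f g ^ n"
  by (induction n) (simp_all add: subst_mult[OF assms])

lemma subst_dvd:
  assumes "\<And>v. const_coeff (g v) = 0" and "f dvd h"
  shows "subst f g dvd subst h g"
  using assms(2) by (auto elim!: dvdE simp: subst_mult[OF assms(1)])

lemma subst_subst:
  assumes g: "\<And>v. const_coeff (g v) = 0" and h: "\<And>v. const_coeff (h v) = 0"
  shows "subst (subst f g) h = subst f (\<lambda>v. subst (g v) h)"
proof (rule additive_continuous_eqI[where e = 0 and f = f and L = "\<lambda>f. subst (subst f g) h"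
          and L' = "\<lambda>f. subst f (\<lambda>v. subst (g v) h)"])
  fix c and \<alpha> :: "'a \<Rightarrow> nat"
  show "subst (subst (scale c (monomial \<alpha>)) g) h = subst (scale c (monomial \<alpha>)) (\<lambda>v. subst (g v) h)"
    by (simp add: subst_scale subst_monomial g h subst_prod subst_power)
qed (simp_all add: subst_add vanishes_below_subst)

lemma subst_Var_id [simp]: "subst f Var = f"
proof (rule additive_continuous_eqI[where e = 0 and f = f and L = "\<lambda>f. subst f Var" and L' = "\<lambda>f. f"])
  have "const_coeff (Var v) = 0" for v :: 'a
    by (auto simp: const_coeff_def Var_def fun_eq_iff)
  then show "subst (scale c (monomial \<alpha>)) Var = scale c (monomial \<alpha>)" for c and \<alpha> :: "'a \<Rightarrow> nat"
    by (simp add: subst_scale subst_monomial flip: monomial_eq_prod)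
qed (simp_all add: subst_add vanishes_below_subst)

lemma const_coeff_Var [simp]: "const_coeff (Var v) = 0"
  by (auto simp: const_coeff_def Var_def fun_eq_iff)

lemma const_coeff_0 [simp]: "const_coeff 0 = 0"
  by (simp add: const_coeff_def)

lemma const_coeff_1 [simp]: "const_coeff 1 = 1"
  by (simp add: const_coeff_def mcoeff_one)

lemma const_coeff_add [simp]: "const_coeff (f + g) = const_coeff f + const_coeff g"
  by (simp add: const_coeff_def)

lemma const_coeff_diff [simp]: "const_coeff (f - g) = const_coeff f - const_coeff g"
  by (simp add: const_coeff_def)

lemma const_coeff_mult [simp]: "const_coeff (f * g) = const_coeff f * const_coeff g"
proof -
  have "{..\<lambda>_::'a. 0::nat} = {\<lambda>_. 0}"
    by (auto simp: le_fun_def fun_eq_iff)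
  then show ?thesis
    by (simp add: const_coeff_def mcoeff_mult)
qed

lemma const_coeff_sum [simp]: "const_coeff (sum f A) = (\<Sum>a\<in>A. const_coeff (f a))"
  by (simp add: const_coeff_def)

lemma const_coeff_conj_series [simp]: "const_coeff (conj_series f) = cnj (const_coeff f)"
  by (simp add: const_coeff_def)

lemma const_coeff_unit: "f dvd 1 \<Longrightarrow> const_coeff f \<noteq> 0"
  by (metis const_coeff_1 const_coeff_mult dvdE mult_zero_left zero_neq_one)

lemma conj_series_add: "conj_series (f + g) = conj_series f + conj_series g"
  by (rule mfps_eqI) simp

lemma conj_series_mult: "conj_series (f * g) = conj_series f * conj_series g"
  by (rule mfps_eqI) (simp add: mcoeff_mult)

lemma conj_series_0 [simp]: "conj_series 0 = 0"
  by (rule mfps_eqI) simp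

lemma conj_series_1 [simp]: "conj_series 1 = 1"
  by (rule mfps_eqI) (simp add: mcoeff_one)

lemma conj_series_Var [simp]: "conj_series (Var v) = Var v"
  by (rule mfps_eqI) (simp add: Var_def)

lemma conj_series_conj_series [simp]: "conj_series (conj_series f) = f"
  by (rule mfps_eqI) simp

lemma conj_series_eq_0_iff [simp]: "conj_series f = 0 \<longleftrightarrow> f = 0"
  by (metis conj_series_0 conj_series_conj_series)

lemma conj_series_of_int [simp]: "conj_series (of_int z) = of_int z"
proof -
  have nat: "conj_series (of_nat n) = of_nat n" for n
    by (induction n) (simp_all add: conj_series_add)
  have "conj_series (- f) = - conj_series f" for f :: "'a mfps"
    by (rule mfps_eqI) simp
  then show ?thesis
    by (cases z rule: int_cases2) (simp_all add: nat)
qed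

lemma conj_series_sum: "conj_series (sum f A) = (\<Sum>a\<in>A. conj_series (f a))"
  by (rule mfps_eqI) simp

lemma conj_series_prod: "conj_series (prod f A) = (\<Prod>a\<in>A. conj_series (f a))"
  by (induction A rule: infinite_finite_induct) (simp_all add: conj_series_mult)

lemma conj_series_power: "conj_series (f ^ n) = conj_series f ^ n"
  by (induction n) (simp_all add: conj_series_mult)

lemma conj_series_subst:
  fixes f :: "'v::finite mfps" and g :: "'v \<Rightarrow> 'u::finite mfps"
  shows "conj_series (subst f g) = subst (conj_series f) (\<lambda>v. conj_series (g v))"
proof (rule mfps_eqI)
  fix \<beta> :: "'u \<Rightarrow> nat"
  have "cnj (mcoeff (\<Prod>v\<in>UNIV. g v ^ \<alpha> v) \<beta>) = mcoeff (\<Prod>v\<in>UNIV. conj_series (g v) ^ \<alpha> v) \<beta>" for \<alpha>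
    by (simp only: mcoeff_conj_series[symmetric] conj_series_prod conj_series_power)
  then show "mcoeff (conj_series (subst f g)) \<beta> = mcoeff (subst (conj_series f) (\<lambda>v. conj_series (g v))) \<beta>"
    by (simp add: mcoeff_subst)
qed

lemma pdiff_add: "pdiff v (f + g) = pdiff v f + pdiff v g"
  by (rule mfps_eqI) (simp add: mcoeff_pdiff distrib_left)

lemma pdiff_scale: "pdiff v (scale c f) = scale c (pdiff v f)"
  by (rule mfps_eqI) (simp add: mcoeff_pdiff)

lemma pdiff_diff: "pdiff v (f - g) = pdiff v f - pdiff v g"
  by (rule mfps_eqI) (simp add: mcoeff_pdiff right_diff_distrib)

lemma pdiff_0 [simp]: "pdiff v 0 = 0"
  by (rule mfps_eqI) (simp add: mcoeff_pdiff)

lemma pdiff_sum: "pdiff v (sum f A) = (\<Sum>a\<in>A. pdiff v (f a))"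
  by (rule mfps_eqI) (simp add: mcoeff_pdiff sum_distrib_left)

lemma pdiff_conj_series: "pdiff v (conj_series f) = conj_series (pdiff v f)"
  by (rule mfps_eqI) (simp add: mcoeff_pdiff)

lemma pdiff_commute: "pdiff u (pdiff v f) = pdiff v (pdiff u f)"
  by (rule mfps_eqI) (auto simp: mcoeff_pdiff fun_upd_twist mult.left_commute)

lemma pdiff_monomial: "pdiff v (monomial \<alpha>) = scale (of_nat (\<alpha> v)) (monomial (\<alpha>(v := \<alpha> v - 1)))"
proof (rule mfps_eqI)
  fix \<beta> :: "'a \<Rightarrow> nat"
  have "\<beta>(v := Suc (\<beta> v)) = \<alpha> \<longleftrightarrow> \<alpha> v \<noteq> 0 \<and> \<beta> = \<alpha>(v := \<alpha> v - 1)"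
    by (auto simp: fun_eq_iff)
  then show "mcoeff (pdiff v (monomial \<alpha>)) \<beta> = mcoeff (scale (of_nat (\<alpha> v)) (monomial (\<alpha>(v := \<alpha> v - 1)))) \<beta>"
    by (auto simp: mcoeff_pdiff mcoeff_monomial)
qed

lemma pdiff_Var: "pdiff u (Var v) = (if u = v then 1 else 0)"
proof -
  have "(\<lambda>u. if u = v then 1 else (0::nat))(v := 0) = (\<lambda>_. 0)"
    by auto
  then show ?thesis
    by (auto simp: Var_eq_monomial pdiff_monomial monomial_0 intro!: mfps_eqI)
qed

lemma pdiff_mult: "pdiff v (f * g) = pdiff v f * g + f * pdiff v g"
proof -
  have monomial: "pdiff v (scale c (monomial \<alpha>) * scale d (monomial \<beta>)) =
      pdiff v (scale c (monomial \<alpha>)) * scale d (monomial \<beta>) + scale c (monomial \<alpha>) * pdiff v (scale d (monomial \<beta>))"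
    for c d \<alpha> \<beta>
  proof -
    have *: "\<alpha> v \<noteq> 0 \<Longrightarrow> (\<lambda>u. (\<alpha>(v := \<alpha> v - 1)) u + \<beta> u) = (\<lambda>u. \<alpha> u + \<beta> u)(v := \<alpha> v + \<beta> v - 1)"
      "\<beta> v \<noteq> 0 \<Longrightarrow> (\<lambda>u. \<alpha> u + (\<beta>(v := \<beta> v - 1)) u) = (\<lambda>u. \<alpha> u + \<beta> u)(v := \<alpha> v + \<beta> v - 1)"
      by auto
    have "pdiff v (monomial \<alpha> * monomial \<beta>) = pdiff v (monomial \<alpha>) * monomial \<beta> + monomial \<alpha> * pdiff v (monomial \<beta>)"
      unfolding monomial_mult pdiff_monomial scale_mult mult_scale
      using * by (cases "\<alpha> v = 0"; cases "\<beta> v = 0") (auto intro!: mfps_eqI simp: distrib_right)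
    then show ?thesis
      by (simp add: scale_mult mult_scale pdiff_scale scale_add)
  qed
  have right: "vanishes_below d (pdiff v p * q + p * pdiff v q)" if "vanishes_below (d + 1) p" for d and p q :: "'a mfps"
    using that vanishes_below_pdiff[of d p v]
    by (intro vanishes_below_add vanishes_below_mult_right) (auto elim: vanishes_below_mono)
  have left: "vanishes_below d (pdiff v p * q + p * pdiff v q)" if "vanishes_below (d + 1) q" for d and p q :: "'a mfps"
    using right[OF that] by (metis add.commute mult.commute)
  have *: "pdiff v (f * scale d (monomial \<beta>)) = pdiff v f * scale d (monomial \<beta>) + f * pdiff v (scale d (monomial \<beta>))" for d \<beta>
    by (rule additive_continuous_eqI[where e = 1 and f = f and L = "\<lambda>f. pdiff v (f * scale d (monomial \<beta>))"
          and L' = "\<lambda>f. pdiff v f * scale d (monomial \<beta>) + f * pdiff v (scale d (monomial \<beta>))", OF _ _ _ right monomial])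
      (auto simp: pdiff_add distrib_right intro: vanishes_below_pdiff vanishes_below_mult_right)
  show ?thesis
    by (rule additive_continuous_eqI[where e = 1 and f = g and L = "\<lambda>g. pdiff v (f * g)"
          and L' = "\<lambda>g. pdiff v f * g + f * pdiff v g", OF _ _ _ left *])
      (auto simp: pdiff_add distrib_left intro: vanishes_below_pdiff vanishes_below_mult_left)
qed

lemma pdiff_1 [simp]: "pdiff v 1 = 0"
  by (rule mfps_eqI) (auto simp: mcoeff_pdiff mcoeff_one fun_eq_iff)

text \<open>
  The series satisfying the chain rule contain the variables and are closed under products, hence
  contain all monomials; density does the rest.
\<close>

lemma chain_rule:
  assumes g: "\<And>v. const_coeff (g v) = 0"
  shows "pdiff u (subst f g) = (\<Sum>v\<in>UNIV. subst (pdiff v f) g * pdiff u (g v))"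
proof (rule additive_continuous_eqI[where e = 1 and f = f and L = "\<lambda>f. pdiff u (subst f g)"
          and L' = "\<lambda>f. \<Sum>v\<in>UNIV. subst (pdiff v f) g * pdiff u (g v)"])
  define R where "R f \<longleftrightarrow> pdiff u (subst f g) = (\<Sum>v\<in>UNIV. subst (pdiff v f) g * pdiff u (g v))" for f
  have R_mult: "R (f * h)" if "R f" "R h" for f h
    using that by (simp add: R_def subst_mult[OF g] pdiff_mult subst_add algebra_simps sum.distrib
        sum_distrib_left sum_distrib_right)
  have R_1: "R 1"
    by (simp add: R_def)
  have R_Var: "R (Var v)" for v
  proof -
    have "(\<Sum>w\<in>UNIV. subst (pdiff w (Var v)) g * pdiff u (g w)) = (\<Sum>w\<in>UNIV. if w = v then pdiff u (g v) else 0)"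
      by (rule sum.cong) (auto simp: pdiff_Var)
    then show ?thesis
      by (simp add: R_def g)
  qed
  have R_power: "R (Var v ^ n)" for v n
    by (induction n) (simp_all add: R_1 R_Var R_mult)
  have "R (\<Prod>v\<in>A. Var v ^ \<alpha> v)" for A \<alpha>
    by (induction A rule: infinite_finite_induct) (simp_all add: R_1 R_power R_mult)
  then have "R (monomial \<alpha>)" for \<alpha>
    by (simp add: monomial_eq_prod)
  then show "pdiff u (subst (scale c (monomial \<alpha>)) g) =
      (\<Sum>v\<in>UNIV. subst (pdiff v (scale c (monomial \<alpha>))) g * pdiff u (g v))" for c \<alpha>
    by (simp add: R_def subst_scale pdiff_scale scale_mult flip: scale_sum)
qed (simp_all add: subst_add pdiff_add distrib_right sum.distrib vanishes_below_subst vanishes_below_pdiff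
    vanishes_below_sum vanishes_below_mult_right)

lemma subst_cong_depends_not_on:
  assumes "\<And>v. g v \<noteq> g' v \<Longrightarrow> depends_not_on f v"
  shows "subst f g = subst f g'"
proof (rule mfps_eqI)
  fix \<beta> :: "'b \<Rightarrow> nat"
  have "mcoeff f \<alpha> * mcoeff (\<Prod>v\<in>UNIV. g v ^ \<alpha> v) \<beta> = mcoeff f \<alpha> * mcoeff (\<Prod>v\<in>UNIV. g' v ^ \<alpha> v) \<beta>" for \<alpha>
  proof (cases "mcoeff f \<alpha> = 0")
    case False
    then have "g v ^ \<alpha> v = g' v ^ \<alpha> v" for v
      using assms[of v] unfolding depends_not_on_def by (cases "g v = g' v"; cases "\<alpha> v = 0") auto
    then show ?thesis by simp
  qed simp
  then show "mcoeff (subst f g) \<beta> = mcoeff (subst f g') \<beta>"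
    by (simp only: mcoeff_subst)
qed

lemma depends_not_on_iff: "depends_not_on f v \<longleftrightarrow> pdiff v f = 0"
proof
  assume "depends_not_on f v"
  then show "pdiff v f = 0"
    by (intro mfps_eqI) (simp add: mcoeff_pdiff depends_not_on_def)
next
  assume f: "pdiff v f = 0"
  show "depends_not_on f v"
    unfolding depends_not_on_def
  proof (intro allI impI)
    fix \<alpha> :: "'a \<Rightarrow> nat"
    assume "\<alpha> v \<noteq> 0"
    then have "\<alpha> = (\<alpha>(v := \<alpha> v - 1))(v := Suc ((\<alpha>(v := \<alpha> v - 1)) v))"
      by auto
    then show "mcoeff f \<alpha> = 0"
      using mcoeff_pdiff[of v f "\<alpha>(v := \<alpha> v - 1)"] f
      by (metis mcoeff_zero mult_eq_0_iff of_nat_eq_0_iff nat.distinct(1))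
  qed
qed

lemma depends_not_on_pdiff: "depends_not_on f v \<Longrightarrow> depends_not_on (pdiff u f) v"
  using pdiff_commute[of v u f] by (simp add: depends_not_on_iff)

lemma const_coeff_pdiff_subst:
  assumes "\<And>v. const_coeff (g v) = 0"
  shows "const_coeff (pdiff u (subst f g)) = (\<Sum>v\<in>UNIV. const_coeff (pdiff v f) * const_coeff (pdiff u (g v)))"
  by (simp add: chain_rule assms)

section \<open>Restriction to coordinate subspaces\<close>

text \<open>
  Substituting \<open>set_zero S\<close> restricts a series to the coordinate subspace on which all variables in \<open>S\<close> vanish.
\<close>

definition set_zero :: "'v::finite set \<Rightarrow> 'v \<Rightarrow> 'v mfps" where
  "set_zero S v = (if v \<in> S then 0 else Var v)"

lemma const_coeff_set_zero [simp]: "const_coeff (set_zero S v) = 0"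
  by (simp add: set_zero_def)

lemma mcoeff_subst_set_zero:
  "mcoeff (subst f (set_zero S)) \<alpha> = (if \<forall>v\<in>S. \<alpha> v = 0 then mcoeff f \<alpha> else 0)"
proof -
  define L' where "L' f = Abs_mfps (\<lambda>\<alpha>. if \<forall>v\<in>S. \<alpha> v = 0 then mcoeff f \<alpha> else 0)" for f :: "'a mfps"
  have "subst f (set_zero S) = L' f"
  proof (rule additive_continuous_eqI[where e = 0 and f = f and L = "\<lambda>f. subst f (set_zero S)"])
    fix c and \<alpha> :: "'a \<Rightarrow> nat"
    have "subst (scale c (monomial \<alpha>)) (set_zero S) =
        scale c (\<Prod>v\<in>UNIV. set_zero S v ^ \<alpha> v)"
      by (rule subst_scale_monomial) auto
    also have "(\<Prod>v\<in>UNIV. set_zero S v ^ \<alpha> v) = (if \<forall>v\<in>S. \<alpha> v = 0 then monomial \<alpha> else 0)"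
    proof (cases "\<forall>v\<in>S. \<alpha> v = 0")
      case True
      then show ?thesis
        unfolding monomial_eq_prod by (auto intro!: prod.cong simp: set_zero_def)
    next
      case False
      then show ?thesis
        by (auto intro!: prod_zero simp: power_0_left set_zero_def)
    qed
    also have "scale c \<dots> = L' (scale c (monomial \<alpha>))"
      by (rule mfps_eqI) (auto simp: L'_def mcoeff_monomial)
    finally show "subst (scale c (monomial \<alpha>)) (set_zero S) = L' (scale c (monomial \<alpha>))" .
  next
    show "L' (f + g) = L' f + L' g" for f g
      by (rule mfps_eqI) (simp add: L'_def)
    show "vanishes_below (d + 0) f \<Longrightarrow> vanishes_below d (L' f)" for d f
      by (simp add: vanishes_below_def L'_def)
  qed (simp_all add: subst_add vanishes_below_subst)
  then show ?thesis
    by (simp add: L'_def)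
qed

lemma subst_set_zero_set_zero: "subst (subst f (set_zero S)) (set_zero T) = subst f (set_zero (S \<union> T))"
proof -
  have "(\<lambda>v. subst (set_zero S v) (set_zero T)) = set_zero (S \<union> T)"
    by (rule ext) (simp add: set_zero_def[of S] set_zero_def[of "S \<union> T"], simp add: set_zero_def)
  then show ?thesis
    by (simp add: subst_subst)
qed

lemma pdiff_subst_set_zero:
  "pdiff u (subst f (set_zero S)) = (if u \<in> S then 0 else subst (pdiff u f) (set_zero S))"
proof -
  have "pdiff u (subst f (set_zero S)) = (\<Sum>v\<in>UNIV. subst (pdiff v f) (set_zero S) * pdiff u (set_zero S v))"
    by (rule chain_rule) simp
  also have "\<dots> = (\<Sum>v\<in>UNIV. if v = u then (if u \<in> S then 0 else subst (pdiff u f) (set_zero S)) else 0)"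
    by (rule sum.cong) (auto simp: set_zero_def pdiff_Var)
  finally show ?thesis by simp
qed

lemma subst_set_zero_eq_self:
  assumes "\<And>v. v \<in> S \<Longrightarrow> depends_not_on f v"
  shows "subst f (set_zero S) = f"
proof -
  have "subst f (set_zero S) = subst f Var"
    by (rule subst_cong_depends_not_on) (auto simp: set_zero_def assms split: if_splits)
  then show ?thesis by simp
qed

lemma subst_set_zero_absorb:
  assumes "\<And>v. const_coeff (g v) = 0" "\<And>v. v \<in> S \<Longrightarrow> g v = 0"
  shows "subst (subst f (set_zero S)) g = subst f g"
proof -
  have "subst (set_zero S v) g = g v" for v
    using assms by (simp add: set_zero_def)
  then show ?thesis
    by (simp add: subst_subst assms(1))
qed

lemma subst_const_zero:
  assumes "const_coeff f = 0"
  shows "subst f (\<lambda>_. 0) = 0"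
proof -
  have "subst f (set_zero UNIV) = 0"
  proof (rule mfps_eqI)
    fix \<alpha> :: "'a \<Rightarrow> nat"
    have "(\<forall>v. \<alpha> v = 0) \<longleftrightarrow> \<alpha> = (\<lambda>_. 0)"
      by auto
    then show "mcoeff (subst f (set_zero UNIV)) \<alpha> = mcoeff 0 \<alpha>"
      using assms by (simp add: mcoeff_subst_set_zero const_coeff_def)
  qed
  then show ?thesis
    using subst_set_zero_absorb[of "\<lambda>_. 0" UNIV f] by simp
qed

lemma subst_Var_inj_eq_0_iff:
  assumes "inj \<iota>"
  shows "subst f (\<lambda>l. Var (\<iota> l)) = 0 \<longleftrightarrow> f = 0"
proof
  assume "subst f (\<lambda>l. Var (\<iota> l)) = 0"
  then have "subst (subst f (\<lambda>l. Var (\<iota> l))) (\<lambda>u. Var (inv \<iota> u)) = 0"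
    by simp
  then show "f = 0"
    using assms by (simp add: subst_subst)
qed simp

lemma subst_Var_inj_set_zero:
  assumes "inj \<iota>"
  shows "subst (subst f (\<lambda>l. Var (\<iota> l))) (set_zero (\<iota> ` S)) = subst (subst f (set_zero S)) (\<lambda>l. Var (\<iota> l))"
proof -
  have "set_zero (\<iota> ` S) (\<iota> l) = subst (set_zero S l) (\<lambda>l. Var (\<iota> l))" for l
    using assms by (auto simp: set_zero_def inj_eq)
  then show ?thesis
    by (simp add: subst_subst)
qed

lemma conj_series_set_zero [simp]: "conj_series (set_zero S v) = set_zero S v"
  by (simp add: set_zero_def)

section \<open>Leading exponents for lexicographic orders\<close>

text \<open>
  Earlier variables of the list are more significant. This is a well-order compatible with addition of
  exponents as soon as the list contains all variables.
\<close>

fun mlex :: "'v list \<Rightarrow> ('v \<Rightarrow> nat) \<Rightarrow> ('v \<Rightarrow> nat) \<Rightarrow> bool" where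
  "mlex [] \<alpha> \<beta> \<longleftrightarrow> False"
| "mlex (v # vs) \<alpha> \<beta> \<longleftrightarrow> \<alpha> v < \<beta> v \<or> \<alpha> v = \<beta> v \<and> mlex vs \<alpha> \<beta>"

lemma wf_mlex: "wf {(\<alpha>, \<beta>). mlex vs \<alpha> \<beta>}"
proof (induction vs)
  case (Cons v vs)
  have "{(\<alpha>, \<beta>). mlex (v # vs) \<alpha> \<beta>} =
      inv_image (less_than <*lex*> {(\<alpha>, \<beta>). mlex vs \<alpha> \<beta>}) (\<lambda>\<alpha>. (\<alpha> v, \<alpha>))"
    by (auto simp: inv_image_def)
  then show ?case
    using Cons.IH by (simp add: wf_inv_image wf_lex_prod del: mlex.simps)
qed simp

lemma mlex_total: "mlex vs \<alpha> \<beta> \<or> mlex vs \<beta> \<alpha> \<or> (\<forall>v\<in>set vs. \<alpha> v = \<beta> v)"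
  by (induction vs) auto

lemma mlex_add:
  "mlex vs (\<lambda>v. \<gamma> v + \<delta> v) (\<lambda>v. \<alpha> v + \<beta> v) \<Longrightarrow> mlex vs \<gamma> \<alpha> \<or> mlex vs \<delta> \<beta>"
proof (induction vs)
  case (Cons v vs)
  then show ?case
    by (cases "\<gamma> v" "\<alpha> v" rule: linorder_cases; cases "\<delta> v" "\<beta> v" rule: linorder_cases) auto
qed simp

text \<open>
  With \<open>mlex_add\<close> this is the cancellation that makes leading exponents additive: if the sum
  of two exponents is kept, enlarging one of them diminishes the other.
\<close>

lemma mlex_add_eq:
  "mlex vs \<alpha> \<gamma> \<Longrightarrow> (\<And>v. \<gamma> v + \<delta> v = \<alpha> v + \<beta> v) \<Longrightarrow> mlex vs \<delta> \<beta>"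
proof (induction vs)
  case (Cons v vs)
  have v: "\<gamma> v + \<delta> v = \<alpha> v + \<beta> v"
    by (rule Cons.prems(2))
  from Cons.prems(1) consider "\<alpha> v < \<gamma> v" | "\<alpha> v = \<gamma> v" "mlex vs \<alpha> \<gamma>"
    by auto
  then show ?case
  proof cases
    case 1
    with v have "\<delta> v < \<beta> v"
      by linarith
    then show ?thesis by simp
  next
    case 2
    have "mlex vs \<delta> \<beta>"
      by (rule Cons.IH[OF 2(2) Cons.prems(2)])
    moreover have "\<delta> v = \<beta> v"
      using v 2(1) by linarith
    ultimately show ?thesis by simp
  qed
qed simp

lemma mlex_append_left:
  assumes "\<forall>v\<in>set vs. \<alpha> v = 0" "\<exists>v\<in>set vs. \<beta> v \<noteq> 0"
  shows "mlex (vs @ us) \<alpha> \<beta>"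
  using assms by (induction vs) auto

text \<open>
  For power series the leading exponent has to be the smallest one, which exists in a well-order.
\<close>

definition is_leading :: "'v list \<Rightarrow> 'v::finite mfps \<Rightarrow> ('v \<Rightarrow> nat) \<Rightarrow> bool" where
  "is_leading vs f \<alpha> \<longleftrightarrow> mcoeff f \<alpha> \<noteq> 0 \<and> (\<forall>\<beta>. mlex vs \<beta> \<alpha> \<longrightarrow> mcoeff f \<beta> = 0)"

lemma ex_leading: "f \<noteq> 0 \<Longrightarrow> \<exists>\<alpha>. is_leading vs f \<alpha>"
proof -
  assume "f \<noteq> 0"
  then obtain \<beta> where "mcoeff f \<beta> \<noteq> 0"
    by (metis mcoeff_zero mfps_eqI)
  then have "\<beta> \<in> {\<alpha>. mcoeff f \<alpha> \<noteq> 0}" by simp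
  from wfE_min[OF wf_mlex[of vs] this] obtain \<alpha> where "\<alpha> \<in> {\<alpha>. mcoeff f \<alpha> \<noteq> 0}"
    "\<And>\<beta>. (\<beta>, \<alpha>) \<in> {(\<alpha>, \<beta>). mlex vs \<alpha> \<beta>} \<Longrightarrow> \<beta> \<notin> {\<alpha>. mcoeff f \<alpha> \<noteq> 0}"
    by metis
  then show ?thesis
    by (auto simp: is_leading_def)
qed

lemma is_leading_unique:
  assumes "set vs = UNIV" "is_leading vs f \<alpha>" "is_leading vs f \<beta>"
  shows "\<alpha> = \<beta>"
  using mlex_total[of vs \<alpha> \<beta>] assms by (auto simp: is_leading_def)

lemma is_leading_mult:
  assumes vs: "set vs = UNIV" and f: "is_leading vs f \<alpha>" and g: "is_leading vs g \<beta>"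
  shows "is_leading vs (f * g) (\<lambda>v. \<alpha> v + \<beta> v)"
  unfolding is_leading_def
proof (intro conjI allI impI)
  have "mcoeff f \<gamma> * mcoeff g (\<lambda>v. \<alpha> v + \<beta> v - \<gamma> v) = (if \<gamma> = \<alpha> then mcoeff f \<alpha> * mcoeff g \<beta> else 0)"
    if "\<gamma> \<le> (\<lambda>v. \<alpha> v + \<beta> v)" for \<gamma>
  proof (cases "\<gamma> = \<alpha>")
    case False
    have eq: "\<gamma> v + (\<alpha> v + \<beta> v - \<gamma> v) = \<alpha> v + \<beta> v" for v
      using that by (simp add: le_fun_def)
    have "mlex vs \<gamma> \<alpha> \<or> mlex vs \<alpha> \<gamma>"
      using mlex_total[of vs \<gamma> \<alpha>] False vs by auto
    then have "mlex vs \<gamma> \<alpha> \<or> mlex vs (\<lambda>v. \<alpha> v + \<beta> v - \<gamma> v) \<beta>"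
      using mlex_add_eq[of vs \<alpha> \<gamma> "\<lambda>v. \<alpha> v + \<beta> v - \<gamma> v" \<beta>] eq by blast
    then show ?thesis
      using f g False by (auto simp: is_leading_def)
  qed simp
  then have "mcoeff (f * g) (\<lambda>v. \<alpha> v + \<beta> v) = (\<Sum>\<gamma>\<le>(\<lambda>v. \<alpha> v + \<beta> v). if \<gamma> = \<alpha> then mcoeff f \<alpha> * mcoeff g \<beta> else 0)"
    unfolding mcoeff_mult by (intro sum.cong) auto
  also have "\<dots> = mcoeff f \<alpha> * mcoeff g \<beta>"
    by (simp add: le_fun_def)
  finally show "mcoeff (f * g) (\<lambda>v. \<alpha> v + \<beta> v) \<noteq> 0"
    using f g by (simp add: is_leading_def)
next
  fix \<epsilon>
  assume \<epsilon>: "mlex vs \<epsilon> (\<lambda>v. \<alpha> v + \<beta> v)"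
  have "mcoeff f \<gamma> * mcoeff g (\<lambda>v. \<epsilon> v - \<gamma> v) = 0" if "\<gamma> \<le> \<epsilon>" for \<gamma>
  proof -
    have "\<epsilon> = (\<lambda>v. \<gamma> v + (\<epsilon> v - \<gamma> v))"
      using that by (auto simp: le_fun_def)
    then have "mlex vs \<gamma> \<alpha> \<or> mlex vs (\<lambda>v. \<epsilon> v - \<gamma> v) \<beta>"
      using \<epsilon> mlex_add[of vs \<gamma> "\<lambda>v. \<epsilon> v - \<gamma> v" \<alpha> \<beta>] by simp
    then show ?thesis
      using f g by (auto simp: is_leading_def)
  qed
  then show "mcoeff (f * g) \<epsilon> = 0"
    unfolding mcoeff_mult by (intro sum.neutral) auto
qed

instance mfps :: (finite) idom
proof
  fix f g :: "'a mfps"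
  assume "f \<noteq> 0" "g \<noteq> 0"
  obtain vs :: "'a list" where vs: "set vs = UNIV"
    using finite_list[of "UNIV :: 'a set"] by auto
  obtain \<alpha> \<beta> where "is_leading vs f \<alpha>" "is_leading vs g \<beta>"
    using ex_leading \<open>f \<noteq> 0\<close> \<open>g \<noteq> 0\<close> by blast
  from is_leading_mult[OF vs this] show "f * g \<noteq> 0"
    by (auto simp: is_leading_def)
qed

text \<open>
  A divisor of \<open>h U\<close>, with \<open>U\<close> a unit and \<open>h\<close> a series in the variables \<open>S\<close> only, is a unit unless it
  vanishes where the variables in \<open>S\<close> do. Unique factorization would give this, but an order in which
  the variables of \<open>S\<close> are the most significant ones suffices. Indeed, the leading exponent of \<open>D\<close> is
  bounded by that of \<open>h\<close>, hence involves only \<open>S\<close>; and it involves no variable of \<open>S\<close>, because \<open>D\<close> has a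
  monomial free of \<open>S\<close>, which is smaller than every monomial that is not.
\<close>

lemma divisor_of_partial_series:
  assumes DP: "D * P = h * U"
    and h: "h \<noteq> 0" "\<And>v. v \<notin> S \<Longrightarrow> depends_not_on h v"
    and U: "const_coeff U \<noteq> 0"
    and D: "subst D (set_zero S) \<noteq> 0"
  shows "const_coeff D \<noteq> 0"
proof -
  obtain ss us where ss: "set ss = S" and us: "set us = - S"
    by (metis finite finite_list)
  define vs where "vs = ss @ us"
  have vs: "set vs = UNIV"
    by (auto simp: vs_def ss us)
  have U_lead: "is_leading vs U (\<lambda>_. 0)"
  proof -
    have "\<not> mlex xs \<beta> (\<lambda>_. 0)" for xs and \<beta> :: "'a \<Rightarrow> nat"
      by (induction xs) auto
    with U show ?thesis
      by (simp add: is_leading_def const_coeff_def)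
  qed
  obtain \<gamma> where \<gamma>: "is_leading vs h \<gamma>"
    using ex_leading h(1) by blast
  have \<gamma>_S: "\<gamma> v = 0" if "v \<notin> S" for v
    using h(2)[OF that] \<gamma> by (auto simp: depends_not_on_def is_leading_def)
  have "h * U \<noteq> 0"
    using is_leading_mult[OF vs \<gamma> U_lead] by (auto simp: is_leading_def)
  with DP have "D \<noteq> 0" "P \<noteq> 0"
    by auto
  then obtain \<alpha> \<beta> where \<alpha>: "is_leading vs D \<alpha>" and \<beta>: "is_leading vs P \<beta>"
    using ex_leading by blast
  have "(\<lambda>v. \<alpha> v + \<beta> v) = (\<lambda>v. \<gamma> v + 0)"
    using is_leading_mult[OF vs \<alpha> \<beta>] is_leading_mult[OF vs \<gamma> U_lead] DP
    by (metis is_leading_unique[OF vs])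
  then have sum_eq: "\<alpha> v + \<beta> v = \<gamma> v" for v
    by (simp add: fun_eq_iff)
  have "\<alpha> v = 0" if "v \<notin> S" for v
    using sum_eq[of v] \<gamma>_S[OF that] by simp
  moreover have "\<alpha> v = 0" if "v \<in> S" for v
  proof (rule ccontr)
    assume "\<alpha> v \<noteq> 0"
    obtain \<delta> where \<delta>: "mcoeff (subst D (set_zero S)) \<delta> \<noteq> 0"
      using D by (metis mcoeff_zero mfps_eqI)
    then have "\<forall>v\<in>S. \<delta> v = 0" "mcoeff D \<delta> \<noteq> 0"
      by (auto simp: mcoeff_subst_set_zero split: if_splits)
    then have "mlex vs \<delta> \<alpha>"
      unfolding vs_def using that \<open>\<alpha> v \<noteq> 0\<close> by (intro mlex_append_left) (auto simp: ss)
    with \<alpha> \<open>mcoeff D \<delta> \<noteq> 0\<close> show False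
      by (auto simp: is_leading_def)
  qed
  ultimately have "\<alpha> = (\<lambda>_. 0)"
    by blast
  with \<alpha> show ?thesis
    by (simp add: is_leading_def const_coeff_def)
qed

section \<open>Determinants and Jacobians\<close>

text \<open>
  The matrix is extended by the identity outside \<open>I\<close>, and \<open>C l j\<close> is the determinant in which row \<open>j\<close>
  is replaced by the \<open>l\<close>-th unit vector. Hence the sum is the determinant with row \<open>j\<close> replaced by row \<open>i\<close>.
\<close>

lemma ex_adjugate:
  fixes A :: "'i::finite \<Rightarrow> 'i \<Rightarrow> 'a::comm_ring_1"
  shows "\<exists>C. \<forall>i\<in>I. \<forall>j\<in>I. (\<Sum>l\<in>I. A i l * C l j) = (if i = j then det_on I A else 0)"
proof -
  define A' where "A' i l = (if i \<in> I \<and> l \<in> I then A i l else if i = l then 1 else 0)" for i l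
  define C where "C l j = det (\<chi> r. if r = j then axis l 1 else (\<chi> c. A' r c))" for l j :: 'i
  have prod_A': "(\<Prod>i\<in>UNIV. A' i (p i)) = (\<Prod>i\<in>I. A i (p i))" if "p permutes I" for p
  proof -
    have "(\<Prod>i\<in>UNIV. A' i (p i)) = (\<Prod>i\<in>I. A' i (p i)) * (\<Prod>i\<in>- I. A' i (p i))"
      by (subst prod.union_disjoint[symmetric]) auto
    also have "(\<Prod>i\<in>- I. A' i (p i)) = 1"
      using that by (intro prod.neutral) (auto simp: A'_def permutes_not_in)
    also have "(\<Prod>i\<in>I. A' i (p i)) = (\<Prod>i\<in>I. A i (p i))"
      using that by (intro prod.cong) (auto simp: A'_def permutes_in_image)
    finally show ?thesis by simp
  qed
  have zero: "(\<Prod>i\<in>UNIV. A' i (p i)) = 0" if "p permutes UNIV" "\<not> p permutes I" for p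
  proof -
    have "\<exists>i. i \<notin> I \<and> p i \<noteq> i"
    proof (rule ccontr)
      assume "\<nexists>i. i \<notin> I \<and> p i \<noteq> i"
      then have "p permutes I"
        using that(1) unfolding permutes_def by blast
      with that(2) show False by simp
    qed
    then obtain i where "i \<notin> I" "p i \<noteq> i"
      by blast
    then have "A' i (p i) = 0"
      by (simp add: A'_def)
    then show ?thesis
      by (intro prod_zero) auto
  qed
  have det_A': "det (\<chi> i j. A' i j) = det_on I A"
  proof -
    have "det (\<chi> i j. A' i j) = (\<Sum>p | p permutes I. of_int (sign p) * (\<Prod>i\<in>UNIV. A' i (p i)))"
      unfolding det_def
    proof (rule sum.mono_neutral_cong_right)
      show "{p. p permutes I} \<subseteq> {p. p permutes UNIV}"
        by (auto intro: permutes_subset)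
    qed (simp_all add: zero finite_permutations)
    also have "\<dots> = det_on I A"
      unfolding det_on_def by (intro sum.cong) (auto simp: prod_A')
    finally show ?thesis .
  qed
  have "(\<Sum>l\<in>I. A i l * C l j) = (if i = j then det_on I A else 0)" if "i \<in> I" "j \<in> I" for i j
  proof -
    have "(\<Sum>l\<in>I. A i l * C l j) = (\<Sum>l\<in>UNIV. A' i l * C l j)"
      using that by (intro sum.mono_neutral_cong_left) (auto simp: A'_def)
    also have "\<dots> = (\<Sum>l\<in>UNIV. det (\<chi> r. if r = j then A' i l *s axis l 1 else (\<chi> c. A' r c)))"
      unfolding C_def by (subst det_row_mul) simp
    also have "\<dots> = det (\<chi> r. if r = j then (\<Sum>l\<in>UNIV. A' i l *s axis l 1) else (\<chi> c. A' r c))"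
      by (rule det_linear_row_sum[symmetric]) simp
    also have "(\<Sum>l\<in>UNIV. A' i l *s axis l 1) = (\<chi> c. A' i c)"
      by (simp add: vec_eq_iff axis_def if_distrib cong: if_cong)
    also have "det (\<chi> r. if r = j then (\<chi> c. A' i c) else (\<chi> c. A' r c)) = (if i = j then det_on I A else 0)"
    proof (cases "i = j")
      case True
      then have "(\<chi> r. if r = j then (\<chi> c. A' i c) else (\<chi> c. A' r c)) = (\<chi> i j. A' i j)"
        by (auto simp: vec_eq_iff)
      with True det_A' show ?thesis by simp
    next
      case False
      then show ?thesis
        by (auto intro!: det_identical_rows[OF False] simp: row_def vec_eq_iff)
    qed
    finally show ?thesis .
  qed
  then show ?thesis by blast
qed

lemma subst_det_on:
  assumes "\<And>v. const_coeff (g v) = 0"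
  shows "subst (det_on I A) g = det_on I (\<lambda>i j. subst (A i j) g)"
  by (simp add: det_on_def subst_sum subst_mult subst_prod assms)

lemma conj_series_det_on: "conj_series (det_on I A) = det_on I (\<lambda>i j. conj_series (A i j))"
  by (simp add: det_on_def conj_series_sum conj_series_mult conj_series_prod)

lemma det_on_kernel_trivial:
  fixes A :: "'i::finite \<Rightarrow> 'i \<Rightarrow> 'a::idom"
  assumes det: "det_on I A \<noteq> 0" and x: "\<And>j. j \<in> I \<Longrightarrow> (\<Sum>i\<in>I. x i * A i j) = 0" and "l \<in> I"
  shows "x l = 0"
proof -
  obtain C where C: "\<forall>i\<in>I. \<forall>j\<in>I. (\<Sum>l\<in>I. A i l * C l j) = (if i = j then det_on I A else 0)"
    using ex_adjugate by blast
  have "0 = (\<Sum>j\<in>I. (\<Sum>i\<in>I. x i * A i j) * C j l)"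
    using x by simp
  also have "\<dots> = (\<Sum>i\<in>I. x i * (\<Sum>j\<in>I. A i j * C j l))"
    unfolding sum_distrib_left sum_distrib_right by (subst sum.swap) (simp add: mult.assoc)
  also have "\<dots> = (\<Sum>i\<in>I. if i = l then x l * det_on I A else 0)"
    using C \<open>l \<in> I\<close> by (intro sum.cong) auto
  also have "\<dots> = x l * det_on I A"
    using \<open>l \<in> I\<close> by simp
  finally show ?thesis
    using det by simp
qed

text \<open>
  If \<open>f\<close> composed with \<open>g\<close> vanishes, then by the chain rule the composed gradient of \<open>f\<close> is in the
  kernel of the Jacobian matrix, so every partial derivative of \<open>f\<close> also vanishes on composition. As
  derivatives lower the degree, this reduces each coefficient of \<open>f\<close> to a constant coefficient, which
  composition preserves.
\<close>

lemma subst_injective_if_Jacobian_nondegenerate: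
  fixes g :: "'v::finite \<Rightarrow> 'u::finite mfps"
  assumes g: "\<And>v. const_coeff (g v) = 0"
    and nondeg: "\<And>x v. (\<And>u. (\<Sum>v\<in>UNIV. x v * pdiff u (g v)) = 0) \<Longrightarrow> x v = 0"
    and f: "subst f g = 0"
  shows "f = 0"
proof -
  have "mcoeff f \<alpha> = 0" if "subst f g = 0" for \<alpha> f
    using that
  proof (induction "sum \<alpha> UNIV" arbitrary: \<alpha> f)
    case 0
    then have "\<alpha> = (\<lambda>_. 0)"
      by (auto simp: fun_eq_iff)
    then show ?case
      using const_coeff_subst[of f g] 0 by (simp add: const_coeff_def)
  next
    case (Suc d)
    then obtain v where v: "\<alpha> v \<noteq> 0"
      by (metis nat.distinct(1) sum.neutral)
    define \<beta> where "\<beta> = \<alpha>(v := \<alpha> v - 1)"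
    have \<alpha>: "\<alpha> = \<beta>(v := Suc (\<beta> v))"
      using v by (auto simp: \<beta>_def)
    have "(\<Sum>v\<in>UNIV. subst (pdiff v f) g * pdiff u (g v)) = 0" for u
      using chain_rule[where g = g, OF g, of u f] Suc.prems by simp
    then have "subst (pdiff v f) g = 0"
      by (rule nondeg)
    moreover have "sum \<alpha> UNIV = Suc (sum \<beta> UNIV)"
      unfolding \<alpha> by (subst (1 2) sum.remove[of UNIV v]) (auto intro!: sum.cong)
    ultimately have "mcoeff (pdiff v f) \<beta> = 0"
      using Suc.hyps by auto
    then show ?case
      unfolding mcoeff_pdiff \<alpha>[symmetric] by (simp del: of_nat_Suc)
  qed
  from this[OF f] show ?thesis
    by (intro mfps_eqI) simp
qed

section \<open>Complexified mappings\<close>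

lemma sum_UNIV_sum_type:
  "(\<Sum>v\<in>(UNIV :: ('a::finite + 'b::finite) set). f v) = (\<Sum>i\<in>UNIV. f (Inl i)) + (\<Sum>i\<in>UNIV. f (Inr i))"
  by (simp add: UNIV_Plus_UNIV[symmetric] sum.Plus del: UNIV_Plus_UNIV)

lemma complexify_Inl: "complexify H (Inl j) = subst (H j) (\<lambda>l. Var (Inl l))"
  by (simp add: complexify_def)

lemma complexify_Inr: "complexify H (Inr j) = subst (conj_series (H j)) (\<lambda>l. Var (Inr l))"
  by (simp add: complexify_def)

lemma const_coeff_complexify:
  assumes "formal_mapping H"
  shows "const_coeff (complexify H v) = 0"
  using assms by (cases v) (simp_all add: complexify_Inl complexify_Inr formal_mapping_def)

lemma subst_complexify_complexify:
  fixes H K :: "'N::finite map_series"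
  assumes H: "formal_mapping H" and K: "formal_mapping K"
  shows "subst (subst f (complexify H)) (complexify K) = subst f (complexify (comp_map H K))"
proof -
  have K0: "const_coeff (K l) = 0" for l
    using K by (simp add: formal_mapping_def)
  have "subst (complexify H v) (complexify K) = complexify (comp_map H K) v" for v
  proof (cases v)
    case (Inl j)
    then show ?thesis
      by (simp add: complexify_Inl subst_subst const_coeff_complexify[OF K] K0 comp_map_def)
  next
    case (Inr j)
    then show ?thesis
      by (simp add: complexify_Inr subst_subst const_coeff_complexify[OF K] K0 comp_map_def conj_series_subst)
  qed
  then show ?thesis
    by (simp add: subst_subst const_coeff_complexify[OF K] const_coeff_complexify[OF H])
qed

lemma complexify_Var: "complexify Var = Var"
proof
  show "complexify Var v = Var v" for v :: "'a + 'a"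
    by (cases v) (simp_all add: complexify_Inl complexify_Inr)
qed

lemma pdiff_subst_Var_inj:
  fixes f :: "'v::finite mfps" and \<iota> :: "'v \<Rightarrow> 'u::finite"
  assumes "inj \<iota>"
  shows "pdiff (\<iota> j) (subst f (\<lambda>l. Var (\<iota> l))) = subst (pdiff j f) (\<lambda>l. Var (\<iota> l))"
proof -
  have "pdiff (\<iota> j) (subst f (\<lambda>l. Var (\<iota> l))) = (\<Sum>l\<in>UNIV. subst (pdiff l f) (\<lambda>l. Var (\<iota> l)) * pdiff (\<iota> j) (Var (\<iota> l)))"
    by (rule chain_rule) simp
  also have "\<dots> = (\<Sum>l\<in>UNIV. if l = j then subst (pdiff j f) (\<lambda>l. Var (\<iota> l)) else 0)"
    using assms by (intro sum.cong) (auto simp: pdiff_Var inj_eq)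
  finally show ?thesis by simp
qed

lemma pdiff_subst_Var_notin:
  assumes "u \<notin> range \<iota>"
  shows "pdiff u (subst f (\<lambda>l. Var (\<iota> l))) = 0"
proof -
  have "pdiff u (subst f (\<lambda>l. Var (\<iota> l))) = (\<Sum>l\<in>UNIV. subst (pdiff l f) (\<lambda>l. Var (\<iota> l)) * pdiff u (Var (\<iota> l)))"
    by (rule chain_rule) simp
  also have "\<dots> = 0"
    using assms by (intro sum.neutral) (auto simp: pdiff_Var)
  finally show ?thesis .
qed

lemma pdiff_complexify:
  "pdiff (Inl j) (complexify H (Inl i)) = subst (pdiff j (H i)) (\<lambda>l. Var (Inl l))"
  "pdiff (Inr j) (complexify H (Inr i)) = subst (conj_series (pdiff j (H i))) (\<lambda>l. Var (Inr l))"
  "pdiff (Inl j) (complexify H (Inr i)) = 0"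
  "pdiff (Inr j) (complexify H (Inl i)) = 0"
  by (auto simp: complexify_Inl complexify_Inr pdiff_subst_Var_inj pdiff_conj_series intro!: pdiff_subst_Var_notin)

section \<open>Defining functions in normal coordinates\<close>

lemma Inl_notin_range_Inr [simp]: "Inl x \<notin> range Inr" "Inr y \<notin> range Inl"
  by auto

lemma normal_Q_independent: "normal_Q k Q \<Longrightarrow> pdiff (Inl k) Q = 0"
  by (simp add: normal_Q_def depends_not_on_iff)

lemma normal_Q_z_zero:
  assumes "normal_Q k Q"
  shows "subst Q (set_zero (range Inl)) = Var (Inr k)"
proof -
  have "subst Q (set_zero (range Inl)) =
      subst Q (case_sum (\<lambda>j. if j = k then Var (Inl j) else 0) (\<lambda>j. Var (Inr j)))"
  proof (rule subst_cong_depends_not_on)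
    fix v :: "'a + 'a"
    assume "set_zero (range Inl) v \<noteq> case_sum (\<lambda>j. if j = k then Var (Inl j) else 0) (\<lambda>j. Var (Inr j)) v"
    then have "v = Inl k"
      by (cases v) (auto simp: set_zero_def split: if_splits)
    with assms show "depends_not_on Q v"
      by (simp add: normal_Q_def)
  qed
  with assms show ?thesis
    by (simp add: normal_Q_def)
qed

lemma normal_Q_\<chi>_zero:
  assumes "normal_Q k Q"
  shows "subst Q (set_zero (Inr ` (- {k}))) = Var (Inr k)"
proof -
  have "set_zero (Inr ` (- {k}) :: ('a + 'a) set) = case_sum (\<lambda>j. Var (Inl j)) (\<lambda>j. if j = k then Var (Inr j) else 0)"
    by (auto simp: set_zero_def fun_eq_iff split: sum.splits)
  with assms show ?thesis
    by (simp add: normal_Q_def)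
qed

lemma normal_Q_\<zeta>_zero:
  assumes "normal_Q k Q"
  shows "subst Q (set_zero (range Inr)) = 0"
proof -
  have "Inr ` (- {k}) \<union> {Inr k} = (range Inr :: ('a + 'a) set)"
    by auto
  then have "subst Q (set_zero (range Inr)) = subst (Var (Inr k)) (set_zero {Inr k})"
    by (metis subst_set_zero_set_zero normal_Q_\<chi>_zero[OF assms])
  then show ?thesis
    by (simp add: set_zero_def)
qed

lemma const_coeff_normal_Q:
  assumes "normal_Q k Q"
  shows "const_coeff Q = 0"
  using const_coeff_subst[of Q "set_zero (range Inr)"] normal_Q_\<zeta>_zero[OF assms] by simp

lemma pdiff_normal_Q_z_zero:
  assumes "normal_Q k Q"
  shows "subst (pdiff (Inr j) Q) (set_zero (range Inl)) = (if j = k then 1 else 0)"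
  using pdiff_subst_set_zero[of "Inr j" Q "range Inl"] normal_Q_z_zero[OF assms]
  by (auto simp: pdiff_Var)

lemma pdiff_normal_Q_\<zeta>_zero:
  assumes "normal_Q k Q"
  shows "subst (pdiff (Inl j) Q) (set_zero (range Inr)) = 0"
  using pdiff_subst_set_zero[of "Inl j" Q "range Inr"] normal_Q_\<zeta>_zero[OF assms]
  by (auto simp: pdiff_Var)

lemma const_coeff_pdiff_normal_Q:
  assumes "normal_Q k Q"
  shows "const_coeff (pdiff (Inl j) Q) = 0" "const_coeff (pdiff (Inr k) Q) = 1"
  using const_coeff_subst[of "pdiff (Inl j) Q" "set_zero (range Inr)"] pdiff_normal_Q_\<zeta>_zero[OF assms]
    const_coeff_subst[of "pdiff (Inr k) Q" "set_zero (range Inl)"] pdiff_normal_Q_z_zero[OF assms]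
  by simp_all

section \<open>Finite type in normal coordinates\<close>

lemma apply_vf_add: "apply_vf (\<lambda>v. X v + Y v) f = apply_vf X f + apply_vf Y f"
  by (simp add: apply_vf_def distrib_right sum.distrib)

lemma apply_vf_scale: "apply_vf (\<lambda>v. scale c (X v)) f = scale c (apply_vf X f)"
  by (simp add: apply_vf_def scale_mult scale_sum)

lemma apply_vf_bracket: "apply_vf (bracket X Y) f = apply_vf X (apply_vf Y f) - apply_vf Y (apply_vf X f)"
proof -
  have *: "apply_vf X (apply_vf Y f) =
      (\<Sum>v\<in>UNIV. apply_vf X (Y v) * pdiff v f) + (\<Sum>u\<in>UNIV. \<Sum>v\<in>UNIV. X u * Y v * pdiff u (pdiff v f))" for X Y :: "'a vfield"
  proof -
    have "apply_vf X (apply_vf Y f) =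
       (\<Sum>u\<in>UNIV. \<Sum>v\<in>UNIV. X u * pdiff u (Y v) * pdiff v f + X u * Y v * pdiff u (pdiff v f))"
      by (simp add: apply_vf_def pdiff_sum pdiff_mult sum_distrib_left algebra_simps)
    also have "\<dots> = (\<Sum>u\<in>UNIV. \<Sum>v\<in>UNIV. X u * pdiff u (Y v) * pdiff v f) +
        (\<Sum>u\<in>UNIV. \<Sum>v\<in>UNIV. X u * Y v * pdiff u (pdiff v f))"
      by (simp add: sum.distrib)
    also have "(\<Sum>u\<in>UNIV. \<Sum>v\<in>UNIV. X u * pdiff u (Y v) * pdiff v f) = (\<Sum>v\<in>UNIV. apply_vf X (Y v) * pdiff v f)"
      by (subst sum.swap) (simp add: apply_vf_def sum_distrib_right)
    finally show ?thesis .
  qed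
  have "(\<Sum>u\<in>UNIV. \<Sum>v\<in>UNIV. X u * Y v * pdiff u (pdiff v f)) =
      (\<Sum>u\<in>UNIV. \<Sum>v\<in>UNIV. Y u * X v * pdiff u (pdiff v f))"
    by (subst sum.swap, intro sum.cong refl) (simp add: pdiff_commute mult.commute)
  then show ?thesis
    unfolding * by (simp add: apply_vf_def bracket_def left_diff_distrib sum_subtractf)
qed

text \<open>
  Suppose that \<open>Q(z, \<chi>, 0) = 0\<close>. Then \<open>{w = \<tau> = 0}\<close> lies in \<open>M\<close>, and every CR field of \<open>M\<close> is
  tangent to it: applying a tangent field \<open>X\<close> to \<open>w - Q\<close> gives \<open>X w = Q\<^sub>\<tau> X \<tau>\<close> there, while \<open>X \<tau> = 0\<close>
  or \<open>X w = 0\<close> by type and \<open>Q\<^sub>\<tau>\<close> is a unit. Tangency is preserved by brackets, so the fields in the Lie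
  algebra do not reach the tangent direction \<open>\<partial>\<^sub>w + \<partial>\<^sub>\<tau>\<close> of \<open>M\<close>. The argument is carried out in the given
  coordinates, with tangency expressed as preservation of the kernel of the restriction \<open>E\<close>; then no
  vector field has to be transformed, and closure under brackets is immediate.
\<close>

lemma finite_type_normal_Q_nonzero:
  fixes \<rho> :: "('N::finite + 'N) mfps"
  assumes ft: "finite_type \<rho>"
    and \<Phi>: "formal_change \<Phi>"
    and a: "a dvd 1"
    and Q: "normal_Q k Q"
    and \<rho>: "subst \<rho> (complexify \<Phi>) = a * (Var (Inl k) - Q)"
  shows "subst Q (set_zero {Inr k}) \<noteq> 0"
proof
  assume Q0: "subst Q (set_zero {Inr k}) = 0"
  obtain \<Psi> where \<Psi>: "formal_mapping \<Psi>" "comp_map \<Phi> \<Psi> = Var" "comp_map \<Psi> \<Phi> = Var" and \<Phi>0: "formal_mapping \<Phi>"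
    using \<Phi> by (auto simp: formal_change_def)
  define \<phi> where "\<phi> = complexify \<Phi>"
  define \<psi> where "\<psi> = complexify \<Psi>"
  have \<phi>0 [simp]: "const_coeff (\<phi> v) = 0" and \<psi>0 [simp]: "const_coeff (\<psi> v) = 0" for v
    using const_coeff_complexify \<Phi>0 \<Psi>(1) by (auto simp: \<phi>_def \<psi>_def)
  have \<phi>\<psi>: "subst (subst f \<phi>) \<psi> = f" and \<psi>\<phi>: "subst (subst f \<psi>) \<phi> = f" for f
    using subst_complexify_complexify[OF \<Phi>0 \<Psi>(1), of f] subst_complexify_complexify[OF \<Psi>(1) \<Phi>0, of f]
    by (simp_all add: \<phi>_def \<psi>_def \<Psi> complexify_Var)
  have \<psi>_\<phi>: "subst (\<psi> u) \<phi> = Var u" for u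
    using \<psi>\<phi>[of "Var u"] by simp
  \<comment> \<open>\<open>\<psi> (Inl k)\<close> and \<open>\<psi> (Inr k)\<close> are \<open>w\<close> and \<open>\<tau>\<close> in the given coordinates, and \<open>E\<close> restricts to their
    common zero set.\<close>
  define W where "W = {Inl k, Inr k :: 'N + 'N}"
  define E where "E f = subst (subst f \<phi>) (set_zero W)" for f
  have sum_W: "(\<Sum>u\<in>W. f u) = f (Inl k) + f (Inr k)" for f :: "'N + 'N \<Rightarrow> ('N + 'N) mfps"
    by (simp add: W_def)
  have E_simps: "E (f + g) = E f + E g" "E (f - g) = E f - E g" "E (f * g) = E f * E g" "E (scale c f) = scale c (E f)"
    "E 0 = 0" "const_coeff (E f) = const_coeff f" "E (sum h A) = (\<Sum>a\<in>A. E (h a))" for f g c h and A :: "('N + 'N) set"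
    by (simp_all add: E_def subst_add subst_diff subst_mult subst_scale subst_sum)
  have E_\<psi>: "E (subst f \<psi>) = subst f (set_zero W)" for f
    by (simp add: E_def \<psi>\<phi>)
  have E_apply: "E (apply_vf X f) = (\<Sum>u\<in>W. subst (pdiff u (subst f \<phi>)) (set_zero W) * E (apply_vf X (\<psi> u)))"
    if "E f = 0" for X f
  proof -
    have "apply_vf X f = (\<Sum>v\<in>UNIV. \<Sum>u\<in>UNIV. X v * (subst (pdiff u (subst f \<phi>)) \<psi> * pdiff v (\<psi> u)))"
      by (subst \<phi>\<psi>[of f, symmetric]) (simp add: apply_vf_def chain_rule sum_distrib_left)
    also have "\<dots> = (\<Sum>u\<in>UNIV. subst (pdiff u (subst f \<phi>)) \<psi> * apply_vf X (\<psi> u))"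
      by (subst sum.swap) (simp add: apply_vf_def sum_distrib_left mult.left_commute)
    finally have "E (apply_vf X f) = (\<Sum>u\<in>UNIV. subst (pdiff u (subst f \<phi>)) (set_zero W) * E (apply_vf X (\<psi> u)))"
      by (simp add: E_simps E_\<psi>)
    also have "\<dots> = (\<Sum>u\<in>W. subst (pdiff u (subst f \<phi>)) (set_zero W) * E (apply_vf X (\<psi> u)))"
    proof (rule sum.mono_neutral_right)
      show "\<forall>u\<in>UNIV - W. subst (pdiff u (subst f \<phi>)) (set_zero W) * E (apply_vf X (\<psi> u)) = 0"
      proof
        fix u
        assume "u \<in> UNIV - W"
        then have "subst (pdiff u (subst f \<phi>)) (set_zero W) = pdiff u (E f)"
          by (simp add: E_def pdiff_subst_set_zero)
        with that show "subst (pdiff u (subst f \<phi>)) (set_zero W) * E (apply_vf X (\<psi> u)) = 0"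
          by simp
      qed
    qed auto
    finally show ?thesis .
  qed
  have QW: "subst Q (set_zero W) = 0"
    using arg_cong[OF Q0, of "\<lambda>f. subst f (set_zero {Inl k})"]
    by (simp add: subst_set_zero_set_zero W_def insert_commute)
  have E\<rho>: "E \<rho> = 0"
  proof -
    have "set_zero W (Inl k) = 0"
      by (simp add: set_zero_def W_def)
    then show ?thesis
      by (simp add: E_def \<phi>_def \<rho> subst_mult subst_diff QW)
  qed
  define aW where "aW = subst a (set_zero W)"
  have aW: "aW \<noteq> 0"
    unfolding aW_def by (metis const_coeff_0 const_coeff_subst const_coeff_unit[OF a])
  define Qw where "Qw = subst (pdiff (Inr k) Q) (set_zero W)"
  have Qw: "Qw \<noteq> 0"
    unfolding Qw_def by (metis const_coeff_0 const_coeff_subst const_coeff_pdiff_normal_Q(2)[OF Q] zero_neq_one)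
  have base: "E (apply_vf X f) = 0"
    if X: "type_1_0 X \<or> type_0_1 X" and tangent: "tangent_vf \<rho> X" and f: "E f = 0" for X f
  proof -
    have w0: "set_zero W (Inl k) = 0"
      by (simp add: set_zero_def W_def)
    have "0 = E (apply_vf X \<rho>)"
      using tangent E\<rho> by (auto simp: tangent_vf_def E_simps elim!: dvdE)
    also have "\<dots> = aW * E (apply_vf X (\<psi> (Inl k))) - aW * Qw * E (apply_vf X (\<psi> (Inr k)))"
      unfolding E_apply[OF E\<rho>] sum_W
      by (simp add: \<phi>_def \<rho> pdiff_mult pdiff_diff pdiff_Var subst_add subst_mult subst_diff
         QW w0 normal_Q_independent[OF Q] aW_def Qw_def)
    finally have eq: "aW * E (apply_vf X (\<psi> (Inl k))) = aW * Qw * E (apply_vf X (\<psi> (Inr k)))"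
      by simp
    have "E (apply_vf X (\<psi> (Inl k))) = 0 \<and> E (apply_vf X (\<psi> (Inr k))) = 0"
    proof (cases "type_1_0 X")
      case True
      then have "apply_vf X (\<psi> (Inr k)) = 0"
        by (simp add: apply_vf_def sum_UNIV_sum_type type_1_0_def \<psi>_def pdiff_complexify)
      with eq aW show ?thesis
        by (simp add: E_simps)
    next
      case False
      with X have "apply_vf X (\<psi> (Inl k)) = 0"
        by (simp add: apply_vf_def sum_UNIV_sum_type type_0_1_def \<psi>_def pdiff_complexify)
      with eq aW Qw show ?thesis
        by (simp add: E_simps)
    qed
    then show ?thesis
      unfolding E_apply[OF f] by (simp add: sum_W)
  qed
  have preserves: "E (apply_vf X f) = 0" if "X \<in> CR_lie_algebra \<rho>" "E f = 0" for X f
    using that unfolding CR_lie_algebra_def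
  proof (induction arbitrary: f rule: lie_algebra_gen.induct)
    case (base X)
    then show ?case
      using \<open>\<And>X f. \<lbrakk>type_1_0 X \<or> type_0_1 X; tangent_vf \<rho> X; E f = 0\<rbrakk> \<Longrightarrow> E (apply_vf X f) = 0\<close> by blast
  next
    case zero
    then show ?case
      by (simp add: apply_vf_def E_simps)
  qed (simp_all add: apply_vf_add apply_vf_scale apply_vf_bracket E_simps)
  \<comment> \<open>\<open>x\<close> is the tangent vector \<open>\<partial>\<^sub>w + \<partial>\<^sub>\<tau>\<close> at the origin, expressed in the given coordinates.\<close>
  define x where "x v = const_coeff (pdiff (Inl k) (\<phi> v)) + const_coeff (pdiff (Inr k) (\<phi> v))" for v
  have x_apply: "(\<Sum>v\<in>UNIV. const_coeff (pdiff v f) * x v) =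
      const_coeff (pdiff (Inl k) (subst f \<phi>)) + const_coeff (pdiff (Inr k) (subst f \<phi>))" for f
    by (simp add: x_def const_coeff_pdiff_subst distrib_left sum.distrib)
  have "(\<Sum>v\<in>UNIV. const_coeff (pdiff v \<rho>) * x v) = 0"
    unfolding x_apply \<phi>_def \<rho>
    by (simp add: pdiff_mult pdiff_diff pdiff_Var const_coeff_pdiff_normal_Q[OF Q] const_coeff_normal_Q[OF Q])
  then have "(\<chi> v. x v) \<in> complex_tangent_space \<rho>"
    by (simp add: complex_tangent_space_def)
  then have "(\<chi> v. x v) \<in> (\<lambda>X. \<chi> v. const_coeff (X v)) ` CR_lie_algebra \<rho>"
    using ft by (simp only: finite_type_def)
  then obtain X where X: "(\<chi> v. x v) = (\<chi> v. const_coeff (X v))" "X \<in> CR_lie_algebra \<rho>"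
    by (rule imageE)
  have "x v = const_coeff (X v)" for v
    using arg_cong[OF X(1), of "\<lambda>y. y $ v"] by simp
  moreover have "E (apply_vf X (\<psi> (Inl k))) = 0"
    by (rule preserves[OF X(2)]) (simp add: E_def \<psi>_\<phi> set_zero_def W_def)
  then have "const_coeff (apply_vf X (\<psi> (Inl k))) = 0"
    by (metis E_simps(6) const_coeff_0)
  ultimately have "(\<Sum>v\<in>UNIV. const_coeff (pdiff v (\<psi> (Inl k))) * x v) = 0"
    by (simp add: apply_vf_def mult.commute)
  then show False
    unfolding x_apply \<psi>_\<phi> by (simp add: pdiff_Var)
qed

section \<open>CR transversality in normal coordinates\<close>

lemma const_coeff_pdiff_subst_complexify:
  assumes "formal_mapping H"
  shows "const_coeff (pdiff (Inl j) (subst f (complexify H))) =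
    (\<Sum>i\<in>UNIV. const_coeff (pdiff (Inl i) f) * const_coeff (pdiff j (H i)))"
  by (simp add: const_coeff_pdiff_subst const_coeff_complexify[OF assms] sum_UNIV_sum_type pdiff_complexify)

text \<open>
  The derivative is \<open>\<partial>\<^sub>Z\<rho>(0)\<close> applied to the image of the \<open>j\<close>-th unit vector under \<open>dH\<close>. If it is nonzero, that
  image spans a complement of the hyperplane \<open>\<partial>\<^sub>Z\<rho>(0) v = 0\<close>.
\<close>

lemma CR_transversal_if_pdiff_nonzero:
  fixes H :: "'N::finite map_series"
  assumes H: "formal_mapping H" and d: "const_coeff (pdiff (Inl j) (subst \<rho> (complexify H))) \<noteq> 0"
  shows "CR_transversal H \<rho>"
proof -
  define d where "d = const_coeff (pdiff (Inl j) (subst \<rho> (complexify H)))"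
  have d_eq: "d = (\<Sum>i\<in>UNIV. const_coeff (pdiff (Inl i) \<rho>) * const_coeff (pdiff j (H i)))"
    by (simp add: d_def const_coeff_pdiff_subst_complexify[OF H])
  have "u \<in> {x + y | x y. x \<in> holo_tangent_space \<rho> \<and> y \<in> range ((*v) (differential_at_0 H))}" for u :: "complex ^ 'N"
  proof -
    define s where "s = (\<Sum>i\<in>UNIV. const_coeff (pdiff (Inl i) \<rho>) * u $ i) / d"
    define y where "y = differential_at_0 H *v axis j s"
    have y: "y $ i = const_coeff (pdiff j (H i)) * s" for i
      by (simp add: y_def differential_at_0_def matrix_vector_mult_def axis_def if_distrib cong: if_cong)
    have "(\<Sum>i\<in>UNIV. const_coeff (pdiff (Inl i) \<rho>) * y $ i) = d * s"
      by (simp add: y d_eq sum_distrib_right mult.assoc)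
    also have "\<dots> = (\<Sum>i\<in>UNIV. const_coeff (pdiff (Inl i) \<rho>) * u $ i)"
      using d by (simp add: s_def d_def)
    finally have "u - y \<in> holo_tangent_space \<rho>"
      by (simp add: holo_tangent_space_def right_diff_distrib sum_subtractf)
    moreover have "y \<in> range ((*v) (differential_at_0 H))"
      by (simp add: y_def)
    moreover have "u = (u - y) + y"
      by simp
    ultimately show ?thesis
      by blast
  qed
  then show ?thesis
    unfolding CR_transversal_def by blast
qed

text \<open>
  In the source coordinates \<open>\<Phi>\<close> the \<open>w\<close>-derivative at the origin of the pulled back defining series is
  \<open>a(0) G\<^sub>w(0)\<close>, because the first derivatives of \<open>Q\<close> in \<open>z\<close> vanish there. It is a combination of the
  \<open>Z\<close>-derivatives in the given coordinates, so one of those is nonzero.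
\<close>

lemma CR_transversal_in_normal_coordinates:
  assumes H: "formal_mapping H" and K: "formal_mapping K" and \<Phi>: "formal_mapping \<Phi>" and \<Phi>': "formal_mapping \<Phi>'"
    and coord: "comp_map \<Phi>' K = comp_map H \<Phi>"
    and a: "a dvd 1" and Q: "normal_Q k Q"
    and \<rho>: "subst \<rho> (complexify \<Phi>') = a * (Var (Inl k) - Q)"
    and G: "const_coeff (pdiff k (K k)) \<noteq> 0"
  shows "CR_transversal H \<rho>"
proof -
  have "subst (subst \<rho> (complexify H)) (complexify \<Phi>) = subst (a * (Var (Inl k) - Q)) (complexify K)"
    by (simp add: subst_complexify_complexify assms flip: \<rho>)
  then have "(\<Sum>j\<in>UNIV. const_coeff (pdiff (Inl j) (subst \<rho> (complexify H))) * const_coeff (pdiff k (\<Phi> j))) =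
      const_coeff (pdiff (Inl k) (subst (a * (Var (Inl k) - Q)) (complexify K)))"
    by (simp only: flip: const_coeff_pdiff_subst_complexify[OF \<Phi>])
  also have "\<dots> = (\<Sum>i\<in>UNIV. const_coeff a * (if i = k then const_coeff (pdiff k (K k)) else 0))"
    unfolding const_coeff_pdiff_subst_complexify[OF K]
    by (intro sum.cong) (auto simp: pdiff_mult pdiff_diff pdiff_Var const_coeff_pdiff_normal_Q[OF Q] const_coeff_normal_Q[OF Q])
  also have "\<dots> = const_coeff a * const_coeff (pdiff k (K k))"
    by (simp flip: sum_distrib_left)
  also have "\<dots> \<noteq> 0"
    using G const_coeff_unit[OF a] by simp
  finally obtain j where "const_coeff (pdiff (Inl j) (subst \<rho> (complexify H))) \<noteq> 0"
    by (metis (no_types, lifting) mult_zero_left sum.neutral)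
  then show ?thesis
    by (rule CR_transversal_if_pdiff_nonzero[OF H])
qed

section \<open>The mapping identity in normal coordinates\<close>

text \<open>
  The elimination described at the beginning: \<open>D0\<close> is the series \<open>D\<close> at \<open>\<tau> = 0\<close>, and \<open>b i j\<close> is the
  derivative of the \<open>i\<close>-th component of \<open>\<bar>K\<close> in the \<open>j\<close>-th variable of \<open>(\<chi>, \<tau>)\<close> at \<open>\<tau> = 0\<close>,
  so \<open>b k k\<close> is \<open>g\<close>, and \<open>r k\<close> is the unit \<open>u\<close>. All series are kept in the full set of variables
  \<open>(z, w, \<chi>, \<tau>)\<close>.
\<close>

lemma normal_component_derivative_nonzero:
  fixes Q R :: "('N::finite + 'N) mfps" and K :: "'N map_series"
  assumes Q: "normal_Q k Q" and R: "normal_Q k R" and K: "formal_mapping K"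
    and into: "Var (Inl k) - Q dvd subst (Var (Inl k) - R) (complexify K)"
    and R0: "subst R (set_zero {Inr k}) \<noteq> 0"
    and nondeg: "not_totally_degenerate k K"
  shows "const_coeff (pdiff k (K k)) \<noteq> 0"
proof -
  define I where "I = - {k}"
  have split_k: "(\<Sum>i\<in>UNIV. f i) = f k + (\<Sum>i\<in>I. f i)" for f :: "'N \<Rightarrow> ('N + 'N) mfps"
    unfolding I_def by (subst sum.remove[of UNIV k]) (auto simp: Compl_eq_Diff_UNIV)
  have K0: "const_coeff (K i) = 0" for i
    using K by (simp add: formal_mapping_def)
  have cK0: "const_coeff (complexify K v) = 0" for v
    by (rule const_coeff_complexify[OF K])
  \<comment> \<open>\<open>s\<close> substitutes \<open>w = Q\<close>, and \<open>\<kappa>\<close> is the complexified mapping after this substitution.\<close>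
  define s where "s v = (if v = Inl k then Q else Var v)" for v
  have s0: "const_coeff (s v) = 0" for v
    by (simp add: s_def const_coeff_normal_Q[OF Q])
  define \<kappa> where "\<kappa> v = subst (complexify K v) s" for v
  have \<kappa>0: "const_coeff (\<kappa> v) = 0" for v
    by (simp add: \<kappa>_def cK0)
  have \<kappa>_Inl: "\<kappa> (Inl i) = subst (K i) (\<lambda>l. s (Inl l))" for i
    by (simp add: \<kappa>_def complexify_Inl subst_subst s0)
  have \<kappa>_Inr: "\<kappa> (Inr i) = complexify K (Inr i)" for i
    by (simp add: \<kappa>_def complexify_Inr subst_subst s0) (simp add: s_def)
  have main: "\<kappa> (Inl k) = subst R \<kappa>"
  proof -
    obtain c where c: "subst (Var (Inl k) - R) (complexify K) = (Var (Inl k) - Q) * c"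
      using into by (elim dvdE)
    have "subst Q s = subst Q Var"
      using Q by (intro subst_cong_depends_not_on) (auto simp: s_def normal_Q_def split: if_splits)
    then have "subst (Var (Inl k) - Q) s = 0"
      by (simp add: subst_diff s0) (simp add: s_def)
    then have "subst (subst (Var (Inl k) - R) (complexify K)) s = 0"
      by (simp add: c subst_mult s0)
    then show ?thesis
      by (simp add: subst_diff subst_subst cK0 s0 \<kappa>_def[abs_def])
  qed
  define \<beta> where "\<beta> i j = subst (conj_series (pdiff j (K i))) (\<lambda>l. Var (Inr l :: 'N + 'N))" for i j
  have pdiff_\<kappa>_Inr: "pdiff (Inr j) (\<kappa> (Inr i)) = \<beta> i j" "pdiff (Inl j) (\<kappa> (Inr i)) = 0" for i j
    by (simp_all add: \<kappa>_Inr \<beta>_def pdiff_complexify)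
  define Kw where "Kw i = subst (pdiff k (K i)) (\<lambda>l. s (Inl l))" for i
  have pdiff_\<kappa>_Inl: "pdiff u (\<kappa> (Inl i)) = Kw i * pdiff u Q" if "u \<notin> Inl ` I" for u i
  proof -
    have "pdiff u (\<kappa> (Inl i)) = (\<Sum>l\<in>UNIV. subst (pdiff l (K i)) (\<lambda>l. s (Inl l)) * pdiff u (s (Inl l)))"
      unfolding \<kappa>_Inl by (rule chain_rule) (rule s0)
    also have "\<dots> = (\<Sum>l\<in>UNIV. if l = k then Kw i * pdiff u Q else 0)"
      using that by (intro sum.cong) (auto simp: s_def Kw_def I_def pdiff_Var)
    finally show ?thesis by simp
  qed
  \<comment> \<open>Since \<open>R\<close> does not depend on \<open>w\<close>, the summand \<open>i = k\<close> is zero; including it keeps the sums uniform.\<close>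
  define D where "D = Kw k - (\<Sum>i\<in>UNIV. subst (pdiff (Inl i) R) \<kappa> * Kw i)"
  have D: "D * pdiff (Inr j) Q = (\<Sum>i\<in>UNIV. subst (pdiff (Inr i) R) \<kappa> * \<beta> i j)" for j
  proof -
    have "Kw k * pdiff (Inr j) Q = pdiff (Inr j) (\<kappa> (Inl k))"
      by (subst pdiff_\<kappa>_Inl) auto
    also have "\<dots> = (\<Sum>v\<in>UNIV. subst (pdiff v R) \<kappa> * pdiff (Inr j) (\<kappa> v))"
      unfolding main by (rule chain_rule) (rule \<kappa>0)
    also have "\<dots> = (\<Sum>i\<in>UNIV. subst (pdiff (Inl i) R) \<kappa> * Kw i) * pdiff (Inr j) Q +
        (\<Sum>i\<in>UNIV. subst (pdiff (Inr i) R) \<kappa> * \<beta> i j)"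
      unfolding sum_UNIV_sum_type sum_distrib_right
      by (subst pdiff_\<kappa>_Inl) (auto simp: pdiff_\<kappa>_Inr mult.assoc)
    finally show ?thesis
      by (simp add: D_def left_diff_distrib)
  qed
  \<comment> \<open>The restrictions to \<open>\<tau> = 0\<close>, to \<open>\<chi> = \<tau> = 0\<close> and to \<open>z = w = 0\<close>.\<close>
  define \<tau>0 where "\<tau>0 = set_zero {Inr k :: 'N + 'N}"
  define \<zeta>0 where "\<zeta>0 = set_zero (range Inr :: ('N + 'N) set)"
  define z0 where "z0 = set_zero (range Inl :: ('N + 'N) set)"
  have [simp]: "const_coeff (\<tau>0 v) = 0" "const_coeff (\<zeta>0 v) = 0" "const_coeff (z0 v) = 0" for v
    by (simp_all add: \<tau>0_def \<zeta>0_def z0_def)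
  have \<tau>0_\<zeta>0: "subst (subst f \<tau>0) \<zeta>0 = subst f \<zeta>0" for f
  proof -
    have "{Inr k} \<union> range Inr = (range Inr :: ('N + 'N) set)"
      by auto
    then show ?thesis
      by (simp add: \<tau>0_def \<zeta>0_def subst_set_zero_set_zero)
  qed
  have \<tau>0_z0: "subst (subst f \<tau>0) z0 = subst (subst f z0) \<tau>0" for f
    by (simp add: \<tau>0_def z0_def subst_set_zero_set_zero Un_commute)
  have s_\<zeta>0: "subst (subst f (\<lambda>l. s (Inl l))) \<zeta>0 = subst (subst f (set_zero {k})) (\<lambda>l. Var (Inl l))" for f
  proof -
    have "subst (s (Inl l)) \<zeta>0 = subst (set_zero {k} l) (\<lambda>l. Var (Inl l))" for l
      using normal_Q_\<zeta>_zero[OF Q] by (simp add: s_def \<zeta>0_def, simp add: set_zero_def)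
    then show ?thesis
      by (simp add: subst_subst s0)
  qed
  have K_\<zeta>0: "subst (\<kappa> (Inl i)) \<zeta>0 = subst (subst (K i) (set_zero {k})) (\<lambda>l. Var (Inl l))" for i
    by (simp add: \<kappa>_Inl s_\<zeta>0)
  have Kw_\<zeta>0: "subst (Kw i) \<zeta>0 = subst (subst (pdiff k (K i)) (set_zero {k})) (\<lambda>l. Var (Inl l))" for i
    by (simp add: Kw_def s_\<zeta>0)
  have \<kappa>_\<zeta>0: "subst (\<kappa> (Inr i)) \<zeta>0 = 0" for i
    by (simp add: \<kappa>_Inr complexify_Inr subst_subst) (simp add: \<zeta>0_def set_zero_def subst_const_zero K0)
  have \<zeta>0_absorb: "subst (subst f \<kappa>) \<zeta>0 = 0" if "subst f \<zeta>0 = 0" for f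
  proof -
    have "subst (subst f \<kappa>) \<zeta>0 = subst f (\<lambda>v. subst (\<kappa> v) \<zeta>0)"
      by (simp add: subst_subst \<kappa>0)
    also have "\<dots> = subst (subst f (set_zero (range Inr))) (\<lambda>v. subst (\<kappa> v) \<zeta>0)"
      by (rule subst_set_zero_absorb[symmetric]) (auto simp: \<kappa>0 \<kappa>_\<zeta>0)
    also have "\<dots> = 0"
      using that by (simp add: \<zeta>0_def)
    finally show ?thesis .
  qed
  \<comment> \<open>At \<open>\<chi> = \<tau> = 0\<close> the basic identity \<open>main\<close> reads \<open>G(z, 0) = R(F(z, 0), 0, 0) = 0\<close>.\<close>
  have G0: "subst (K k) (set_zero {k}) = 0"
  proof -
    have "subst (\<kappa> (Inl k)) \<zeta>0 = 0"
      unfolding main by (rule \<zeta>0_absorb) (simp add: \<zeta>0_def normal_Q_\<zeta>_zero[OF R])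
    then show ?thesis
      by (simp add: K_\<zeta>0 subst_Var_inj_eq_0_iff)
  qed
  \<comment> \<open>\<open>m\<close> is the Jacobian matrix of \<open>K\<close> at \<open>w = 0\<close>; its block without the index \<open>k\<close> is \<open>F\<^sub>z(z, 0)\<close>,
    and \<open>b\<close> is its conjugate in the variables \<open>\<chi>\<close>.\<close>
  define m where "m i j = subst (pdiff j (K i)) (set_zero {k})" for i j
  have pdiff_m: "pdiff j (subst (K i) (set_zero {k})) = m i j" if "j \<in> I" for i j
    using that by (simp add: pdiff_subst_set_zero m_def I_def)
  have det_m: "det_on I m \<noteq> 0"
  proof -
    have "(\<lambda>j. if j = k then 0 else Var j) = set_zero {k}"
      by (auto simp: set_zero_def)
    then show ?thesis
      using nondeg by (simp add: not_totally_degenerate_def subst_det_on I_def m_def[abs_def])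
  qed
  define b where "b i j = subst (\<beta> i j) \<tau>0" for i j
  have b: "b i j = subst (conj_series (m i j)) (\<lambda>l. Var (Inr l))" for i j
    using subst_Var_inj_set_zero[of "Inr :: 'N \<Rightarrow> 'N + 'N" "conj_series (pdiff j (K i))" "{k}"]
    by (simp add: b_def \<beta>_def \<tau>0_def m_def conj_series_subst)
  have \<kappa>_\<tau>0: "subst (\<kappa> (Inr k)) \<tau>0 = 0"
    using subst_Var_inj_set_zero[of "Inr :: 'N \<Rightarrow> 'N + 'N" "conj_series (K k)" "{k}"]
      arg_cong[OF G0, of conj_series]
    by (simp add: \<kappa>_Inr complexify_Inr \<tau>0_def conj_series_subst)
  have b_k: "b k j = 0" if "j \<in> I" for j
    using pdiff_m[OF that, of k] by (simp add: b G0)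
  define \<delta> where "\<delta> = det_on I b"
  have \<delta>: "\<delta> = subst (conj_series (det_on I m)) (\<lambda>l. Var (Inr l))"
    by (simp add: \<delta>_def b[abs_def] subst_det_on conj_series_det_on)
  have \<delta>_nonzero: "\<delta> \<noteq> 0"
    using det_m by (simp add: \<delta> subst_Var_inj_eq_0_iff)
  have \<delta>_z0: "subst \<delta> z0 = \<delta>"
    by (simp add: \<delta> subst_subst) (simp add: z0_def set_zero_def)
  define q where "q j = subst (pdiff (Inr j) Q) \<tau>0" for j
  have q_z0: "subst (q j) z0 = (if j = k then 1 else 0)" for j
    by (simp add: q_def \<tau>0_z0) (simp add: z0_def pdiff_normal_Q_z_zero[OF Q])
  define r where "r i = subst (subst (pdiff (Inr i) R) \<kappa>) \<tau>0" for i
  define D0 where "D0 = subst D \<tau>0"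
  have D0: "D0 * q j = r k * b k j + (\<Sum>i\<in>I. r i * b i j)" for j
    using arg_cong[OF D[of j], of "\<lambda>f. subst f \<tau>0"]
    by (simp add: subst_mult subst_sum subst_add D0_def q_def r_def b_def split_k)
  obtain C where C: "\<forall>i\<in>I. \<forall>j\<in>I. (\<Sum>l\<in>I. b i l * C l j) = (if i = j then \<delta> else 0)"
    using ex_adjugate[of I b] unfolding \<delta>_def by blast
  \<comment> \<open>For \<open>j \<noteq> k\<close> the system contains only the \<open>r i\<close> with \<open>i \<noteq> k\<close>, as \<open>b k j = 0\<close>; it is solved by Cramer's rule.\<close>
  have r_\<delta>: "(\<Sum>j\<in>I. D0 * q j * C j l) = r l * \<delta>" if "l \<in> I" for l
  proof -
    have "(\<Sum>j\<in>I. D0 * q j * C j l) = (\<Sum>j\<in>I. \<Sum>i\<in>I. r i * b i j * C j l)"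
      by (intro sum.cong refl) (simp add: D0 b_k sum_distrib_right)
    also have "\<dots> = (\<Sum>i\<in>I. r i * (\<Sum>j\<in>I. b i j * C j l))"
      by (subst sum.swap) (simp add: sum_distrib_left mult.assoc)
    also have "\<dots> = (\<Sum>i\<in>I. if i = l then r l * \<delta> else 0)"
      using C that by (intro sum.cong) auto
    finally show ?thesis
      using that by simp
  qed
  define P where "P = q k * \<delta> - (\<Sum>l\<in>I. (\<Sum>j\<in>I. q j * C j l) * b l k)"
  have "D0 * P = D0 * q k * \<delta> - (\<Sum>l\<in>I. (\<Sum>j\<in>I. D0 * q j * C j l) * b l k)"
    by (simp add: P_def right_diff_distrib sum_distrib_left sum_distrib_right mult.assoc)
  also have "(\<Sum>l\<in>I. (\<Sum>j\<in>I. D0 * q j * C j l) * b l k) = (\<Sum>l\<in>I. r l * \<delta> * b l k)"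
    by (intro sum.cong refl) (simp only: r_\<delta>)
  also have "\<dots> = (\<Sum>l\<in>I. r l * b l k) * \<delta>"
    unfolding sum_distrib_right by (simp only: mult_ac)
  also have "D0 * q k * \<delta> - (\<Sum>l\<in>I. r l * b l k) * \<delta> = \<delta> * b k k * r k"
    by (simp add: D0 algebra_simps)
  finally have D0_P: "D0 * P = \<delta> * b k k * r k" .
  have "subst P z0 = \<delta>"
  proof -
    have "(\<Sum>l\<in>I. (\<Sum>j\<in>I. subst (q j) z0 * subst (C j l) z0) * subst (b l k) z0) = 0"
      by (intro sum.neutral) (auto simp: q_z0 I_def)
    then show ?thesis
      by (simp add: P_def subst_diff subst_mult subst_sum q_z0 \<delta>_z0)
  qed
  with \<delta>_nonzero have P_nonzero: "P \<noteq> 0"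
    by auto
  \<comment> \<open>If \<open>g = 0\<close>, then \<open>R(z, \<chi>, 0) = 0\<close>, against \<open>R0\<close>.\<close>
  have bkk_nonzero: "b k k \<noteq> 0"
  proof
    assume "b k k = 0"
    with D0_P P_nonzero have D0_zero: "D0 = 0"
      by simp
    have r_zero: "r l = 0" if "l \<in> I" for l
      using r_\<delta>[OF that] \<delta>_nonzero by (simp add: D0_zero)
    \<comment> \<open>The map \<open>(z, \<chi>) \<mapsto> (F(z, \<theta>), \<bar>F(\<chi>, 0))\<close>, extended by the identity in \<open>w\<close> and \<open>\<tau>\<close> so that
      source and target have the same variables.\<close>
    define \<Psi> where "\<Psi> v = (if v \<in> {Inl k, Inr k} then Var v else subst (\<kappa> v) \<tau>0)" for v
    have \<Psi>0: "const_coeff (\<Psi> v) = 0" for v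
      by (simp add: \<Psi>_def \<kappa>0)
    define A where "A i j = pdiff (Inl j) (subst (\<kappa> (Inl i)) \<tau>0)" for i j
    \<comment> \<open>At \<open>\<chi> = 0\<close> the series \<open>\<theta>\<close> vanishes, so the \<open>z\<close>-block of the Jacobian matrix becomes \<open>F\<^sub>z(z, 0)\<close>.\<close>
    have det_A: "det_on I A \<noteq> 0"
    proof -
      have "subst (A i j) \<zeta>0 = subst (m i j) (\<lambda>l. Var (Inl l))" if "j \<in> I" for i j
      proof -
        have "subst (A i j) \<zeta>0 = pdiff (Inl j) (subst (\<kappa> (Inl i)) \<zeta>0)"
          unfolding \<tau>0_\<zeta>0[of "\<kappa> (Inl i)", symmetric] A_def by (simp add: \<zeta>0_def pdiff_subst_set_zero)
        then show ?thesis
          using that by (simp add: K_\<zeta>0 pdiff_subst_Var_inj pdiff_m)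
      qed
      then have "subst (det_on I A) \<zeta>0 = subst (det_on I m) (\<lambda>l. Var (Inl l))"
        by (auto simp: subst_det_on det_on_def permutes_in_image subst_sum subst_mult subst_prod intro!: sum.cong prod.cong)
      with det_m show ?thesis
        by (auto simp: subst_Var_inj_eq_0_iff)
    qed
    \<comment> \<open>The Jacobian matrix is block triangular: the second block row \<open>\<bar>F(\<chi>, 0)\<close> does not involve \<open>z\<close>,
      so the \<open>z\<close>-columns determine the first part of \<open>x\<close> and the \<open>\<chi>\<close>-columns then the second.\<close>
    have nondeg: "x v = 0" if x: "\<And>u. (\<Sum>v\<in>UNIV. x v * pdiff u (\<Psi> v)) = 0" for x :: "'N + 'N \<Rightarrow> ('N + 'N) mfps" and v
    proof -
      have sum_x: "x (Inl k) * pdiff u (Var (Inl k)) + (\<Sum>i\<in>I. x (Inl i) * pdiff u (subst (\<kappa> (Inl i)) \<tau>0)) +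
          (x (Inr k) * pdiff u (Var (Inr k)) + (\<Sum>i\<in>I. x (Inr i) * pdiff u (subst (\<kappa> (Inr i)) \<tau>0))) = 0" for u
      proof -
        have "\<Psi> (Inl i) = subst (\<kappa> (Inl i)) \<tau>0" "\<Psi> (Inr i) = subst (\<kappa> (Inr i)) \<tau>0" if "i \<in> I" for i
          using that by (auto simp: \<Psi>_def I_def)
        then show ?thesis
          using x[of u] by (simp add: sum_UNIV_sum_type split_k) (simp add: \<Psi>_def)
      qed
      have pdiff_Inr: "pdiff (Inl j) (subst (\<kappa> (Inr i)) \<tau>0) = 0" "pdiff (Inr j) (subst (\<kappa> (Inr i)) \<tau>0) = (if j = k then 0 else b i j)" for i j
        by (simp_all add: \<tau>0_def pdiff_subst_set_zero pdiff_\<kappa>_Inr b_def)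
      have xk: "x (Inr k) = 0"
        using sum_x[of "Inr k"] by (simp add: pdiff_Var \<tau>0_def pdiff_subst_set_zero)
      have "pdiff (Inl k) (subst (\<kappa> (Inl i)) \<tau>0) = 0" for i
        by (simp add: \<tau>0_def pdiff_subst_set_zero pdiff_\<kappa>_Inl normal_Q_independent[OF Q] I_def image_iff)
      then have "x (Inl k) = 0"
        using sum_x[of "Inl k"] by (simp add: pdiff_Var pdiff_Inr)
      moreover have x_Inl: "x (Inl i) = 0" if "i \<in> I" for i
      proof (rule det_on_kernel_trivial[OF det_A _ that])
        show "(\<Sum>i\<in>I. x (Inl i) * A i j) = 0" if "j \<in> I" for j
          using sum_x[of "Inl j"] that by (auto simp: pdiff_Var pdiff_Inr A_def I_def)
      qed
      moreover have x_Inr: "x (Inr i) = 0" if "i \<in> I" for i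
      proof (rule det_on_kernel_trivial[OF \<delta>_nonzero[unfolded \<delta>_def] _ that])
        show "(\<Sum>i\<in>I. x (Inr i) * b i j) = 0" if "j \<in> I" for j
          using sum_x[of "Inr j"] that by (auto simp: pdiff_Var pdiff_Inr x_Inl I_def)
      qed
      ultimately show ?thesis
        using xk unfolding I_def by (cases v) (metis ComplI singletonD)+
    qed
    have "subst (pdiff (Inr l) R) \<tau>0 = 0" if "l \<in> I" for l
    proof (rule subst_injective_if_Jacobian_nondegenerate[where g = \<Psi>])
      show "const_coeff (\<Psi> v) = 0" for v
        by (rule \<Psi>0)
      show "x v = 0" if "\<And>u. (\<Sum>v\<in>UNIV. x v * pdiff u (\<Psi> v)) = 0" for x v
        using that by (rule nondeg)
      have "subst (subst (pdiff (Inr l) R) \<tau>0) \<Psi> = subst (pdiff (Inr l) R) (\<lambda>v. subst (\<tau>0 v) \<Psi>)"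
        by (simp add: subst_subst \<Psi>0)
      also have "\<dots> = subst (pdiff (Inr l) R) (\<lambda>v. subst (\<kappa> v) \<tau>0)"
      proof (rule subst_cong_depends_not_on)
        fix v
        assume neq: "subst (\<tau>0 v) \<Psi> \<noteq> subst (\<kappa> v) \<tau>0"
        have "v = Inl k"
        proof (rule ccontr)
          assume "v \<noteq> Inl k"
          then show False
            using neq \<kappa>_\<tau>0 \<Psi>0 by (cases "v = Inr k") (simp_all add: \<tau>0_def set_zero_def \<Psi>_def)
        qed
        then show "depends_not_on (pdiff (Inr l) R) v"
          using R by (simp add: normal_Q_def depends_not_on_pdiff)
      qed
      also have "\<dots> = r l"
        by (simp add: r_def subst_subst \<kappa>0)
      finally show "subst (subst (pdiff (Inr l) R) \<tau>0) \<Psi> = 0"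
        using r_zero[OF that] by simp
    qed
    then have "pdiff (Inr l) (subst R \<tau>0) = 0" for l
      by (simp add: \<tau>0_def pdiff_subst_set_zero I_def)
    then have "subst (subst R \<tau>0) \<zeta>0 = subst R \<tau>0"
      unfolding \<zeta>0_def by (intro subst_set_zero_eq_self) (auto simp: depends_not_on_iff)
    moreover have "subst (subst R \<tau>0) \<zeta>0 = 0"
      by (simp add: \<tau>0_\<zeta>0) (simp add: \<zeta>0_def normal_Q_\<zeta>_zero[OF R])
    ultimately show False
      using R0 by (simp add: \<tau>0_def)
  qed
  have "const_coeff D0 \<noteq> 0"
  proof (rule divisor_of_partial_series[OF D0_P])
    show "\<delta> * b k k \<noteq> 0"
      using \<delta>_nonzero bkk_nonzero by simp
    show "depends_not_on (\<delta> * b k k) v" if "v \<notin> range Inr" for v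
      using that by (simp add: depends_not_on_iff pdiff_mult \<delta> b pdiff_subst_Var_notin)
    show "const_coeff (r k) \<noteq> 0"
      by (simp add: r_def const_coeff_pdiff_normal_Q[OF R])
    have "subst (subst (pdiff (Inl i) R) \<kappa>) \<zeta>0 = 0" for i
      by (rule \<zeta>0_absorb) (simp add: \<zeta>0_def pdiff_normal_Q_\<zeta>_zero[OF R])
    then have "subst D0 \<zeta>0 = subst (Kw k) \<zeta>0"
      by (simp add: D0_def \<tau>0_\<zeta>0 D_def subst_diff subst_sum subst_mult)
    also have "\<dots> = subst (m k k) (\<lambda>l. Var (Inl l))"
      by (simp add: Kw_\<zeta>0 m_def)
    also have "\<dots> \<noteq> 0"
      using bkk_nonzero by (simp add: b subst_Var_inj_eq_0_iff)
    finally show "subst D0 (set_zero (range Inr)) \<noteq> 0"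
      by (simp add: \<zeta>0_def)
  qed
  then show ?thesis
    by (simp add: D0_def D_def Kw_def const_coeff_pdiff_normal_Q[OF R])
qed

section \<open>The transversality theorem\<close>

theorem theorem4p1:
  fixes \<rho> \<rho>' :: "('N::finite + 'N) mfps"
    and H K \<Phi> \<Phi>' :: "'N map_series"
    and k :: 'N
  assumes "formal_real_hypersurface \<rho>"
    and "formal_real_hypersurface \<rho>'"
    and "formal_mapping H"
    and "maps_into H \<rho> \<rho>'"
    and "finite_type \<rho>'"
    and "normal_coordinates k \<rho> \<Phi>"
    and "normal_coordinates k \<rho>' \<Phi>'"
    and "in_coordinates \<Phi> \<Phi>' H K"
    and "not_totally_degenerate k K"
  shows "CR_transversal H \<rho>'"
proof -
  note H = \<open>formal_mapping H\<close>
  obtain a Q where \<Phi>: "formal_change \<Phi>" and Q: "normal_Q k Q"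
    and \<rho>: "subst \<rho> (complexify \<Phi>) = a * (Var (Inl k) - Q)"
    using \<open>normal_coordinates k \<rho> \<Phi>\<close> by (auto simp: normal_coordinates_def)
  obtain a' R where \<Phi>': "formal_change \<Phi>'" and a': "a' dvd 1" and R: "normal_Q k R"
    and \<rho>': "subst \<rho>' (complexify \<Phi>') = a' * (Var (Inl k) - R)"
    using \<open>normal_coordinates k \<rho>' \<Phi>'\<close> by (auto simp: normal_coordinates_def)
  have \<Phi>0: "formal_mapping \<Phi>" and \<Phi>'0: "formal_mapping \<Phi>'"
    using \<Phi> \<Phi>' by (auto simp: formal_change_def)
  have K: "formal_mapping K" and coord: "comp_map \<Phi>' K = comp_map H \<Phi>"
    using \<open>in_coordinates \<Phi> \<Phi>' H K\<close> by (auto simp: in_coordinates_def)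
  have "subst \<rho> (complexify \<Phi>) dvd subst (subst \<rho>' (complexify H)) (complexify \<Phi>)"
    using \<open>maps_into H \<rho> \<rho>'\<close> by (auto simp: maps_into_def subst_mult const_coeff_complexify[OF \<Phi>0])
  also have "subst (subst \<rho>' (complexify H)) (complexify \<Phi>) = subst (subst \<rho>' (complexify \<Phi>')) (complexify K)"
    by (simp add: subst_complexify_complexify H K \<Phi>0 \<Phi>'0 coord)
  also have "\<dots> = subst a' (complexify K) * subst (Var (Inl k) - R) (complexify K)"
    by (simp add: \<rho>' subst_mult const_coeff_complexify[OF K])
  finally have dvd: "Var (Inl k) - Q dvd subst a' (complexify K) * subst (Var (Inl k) - R) (complexify K)"
    unfolding \<rho> by (rule dvd_mult_right)
  have "subst a' (complexify K) dvd 1"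
    using subst_dvd[where g = "complexify K", OF const_coeff_complexify[OF K] a'] by simp
  then obtain e where e: "1 = subst a' (complexify K) * e"
    by (elim dvdE)
  have "subst (Var (Inl k) - R) (complexify K) = 1 * subst (Var (Inl k) - R) (complexify K)"
    by simp
  also have "\<dots> = e * (subst a' (complexify K) * subst (Var (Inl k) - R) (complexify K))"
    unfolding e by (simp only: mult_ac)
  finally have "Var (Inl k) - Q dvd subst (Var (Inl k) - R) (complexify K)"
    using dvd_mult[OF dvd, of e] by (simp only:)
  then have "const_coeff (pdiff k (K k)) \<noteq> 0"
    using Q R K finite_type_normal_Q_nonzero[OF \<open>finite_type \<rho>'\<close> \<Phi>' a' R \<rho>'] \<open>not_totally_degenerate k K\<close>
    by (intro normal_component_derivative_nonzero)
  then show ?thesis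
    by (rule CR_transversal_in_normal_coordinates[OF H K \<Phi>0 \<Phi>'0 coord a' R \<rho>'])
qed

end
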